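(* Let $(S^n,q^n)_{n\ge 1}$ be a sequence of continuous time Markov chains on finite sets $S^n$ with $|S^n|\ge 2$, such that $\lim_{n\to\infty}|S^n|=\infty$ and $\sup_n q^n_{\max}<\infty$. Assume further that there is a constant $C$ such that for each $n$ there is a stationary distribution for $(S^n,q^n)$ for which the ratio of the largest to the smallest point mass is at most $C$. Then, for each $\varepsilon\in(0,1)$, the $\varepsilon$-mixing time $t^n_{\mathtt{mix}}(\varepsilon)$ of the noisy voter model with voting mechanism $(S^n,q^n)$ satisfies $$t^n_{\mathtt{mix}}(\varepsilon)=\tfrac12\log|S^n|\,(1+o(1))\qquad\text{as } n\to\infty.$$ Moreover, $$\lim_{\alpha\to\infty}\liminf_{n\to\infty}\bigl\|\mu^{n,\mathbf 1}_{\frac12\log|S^n|-\alpha}-\mu^n_\infty\bigr\|_{\mathtt{TV}}=1,$$ where $\mathbf 1$ denotes the configuration of all 1's, and $$\lim_{\alpha\to\infty}\limsup_{n\to\infty}\max_{\eta\in\{0,1\}^{S^n}}\bigl\|\mu^{n,\eta}_{\frac12\log|S^n|+\alpha}-\mu^n_\infty\bigr\|_{\mathtt{TV}}=0.$$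
   Context: A continuous time Markov chain on a finite set $S$ ($|S|\ge2$) is given by rates $q(x,y)\ge 0$ for going from $x$ to $y$ ($x\ne y$); it need not be irreducible. Set $q_{\max}:=\max\{\sum_{y\ne x}q(x,y): x\in S\}$, and write $q^n_{\max}$ for this quantity for $(S^n,q^n)$. The noisy voter model with voting mechanism $(S,q)$ is the continuous time Markov chain $\{\eta_t\}_{t\ge0}$ on $\{0,1\}^S$ in which, independently, (1) for each two sites $x\neq y$, the state at $x$ changes to the value of the state at $y$ at rate $q(x,y)$, and (2) each site rerandomizes its state at rate 1 (i.e. its state is replaced by 0 or 1 with probability $1/2$ each, independently of everything else). Equivalently, when the configuration is $\eta$, independently at each $x\in S$, the state at $x$ changes $0\to1$ at rate $\frac12+\sum_{y\ne x}q(x,y)\eta(y)$ if $\eta(x)=0$, and $1\to0$ at rate $\frac12+\sum_{y\ne x}q(x,y)(1-\eta(y))$ if $\eta(x)=1$. This chain is irreducible and so has a unique stationary distribution $\mu_\infty$. Let $\mu^{\eta}_t$ denote the law of $\eta_t$ when $\eta_0=\eta$. For the $n$th system $(S^n,q^n)$ these are denoted $\mu^n_\infty$ and $\mu^{n,\eta}_t$. Total variation distance between probability measures on a finite set $\Omega$: $\|m_1-m_2\|_{\mathtt{TV}}:=\frac12\sum_{s\in\Omega}|m_1(s)-m_2(s)|$. The $\varepsilon$-mixing time is $t_{\mathtt{mix}}(\varepsilon):=\inf\{t\ge0:\max_{\eta\in\{0,1\}^S}\|\mu^\eta_t-\mu_\infty\|_{\mathtt{TV}}\le\varepsilon\}$,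 written $t^n_{\mathtt{mix}}(\varepsilon)$ for the $n$th system. *)

theory Defs
  imports "HOL-Probability.Probability"
begin

text \<open>
  A continuous time Markov chain on a finite set \<open>\<Omega>\<close> is given by its jump rates
  \<open>r x y\<close> for \<open>x \<noteq> y\<close> in \<open>\<Omega>\<close>. The values \<open>r x x\<close> are never used.
\<close>

definition generator :: "'s set \<Rightarrow> ('s \<Rightarrow> 's \<Rightarrow> real) \<Rightarrow> 's \<Rightarrow> 's \<Rightarrow> real" where
  "generator \<Omega> r x y = (if x = y then - (\<Sum>z\<in>\<Omega> - {x}. r x z) else r x y)"

primrec generator_power :: "'s set \<Rightarrow> ('s \<Rightarrow> 's \<Rightarrow> real) \<Rightarrow> nat \<Rightarrow> 's \<Rightarrow> 's \<Rightarrow> real" where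
  "generator_power \<Omega> r 0 x y = (if x = y then 1 else 0)"
| "generator_power \<Omega> r (Suc k) x y =
     (\<Sum>z\<in>\<Omega>. generator \<Omega> r x z * generator_power \<Omega> r k z y)"

text \<open>
  The transition function is the matrix exponential \<open>exp (t Q)\<close> of the generator \<open>Q\<close>, entry by
  entry. For \<open>t \<ge> 0\<close>, the row \<open>transition \<Omega> r t x\<close> is the mass function on \<open>\<Omega>\<close> of the law at
  time \<open>t\<close> of the chain started at \<open>x\<close>.
\<close>

definition transition :: "'s set \<Rightarrow> ('s \<Rightarrow> 's \<Rightarrow> real) \<Rightarrow> real \<Rightarrow> 's \<Rightarrow> 's \<Rightarrow> real" where
  "transition \<Omega> r t x y = (\<Sum>k. t ^ k / fact k * generator_power \<Omega> r k x y)"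

definition stationary :: "'s set \<Rightarrow> ('s \<Rightarrow> 's \<Rightarrow> real) \<Rightarrow> 's pmf \<Rightarrow> bool" where
  "stationary \<Omega> r p \<longleftrightarrow> set_pmf p \<subseteq> \<Omega> \<and>
     (\<forall>t\<ge>0. \<forall>y\<in>\<Omega>. (\<Sum>x\<in>\<Omega>. pmf p x * transition \<Omega> r t x y) = pmf p y)"

definition tv_dist :: "'s set \<Rightarrow> ('s \<Rightarrow> real) \<Rightarrow> ('s \<Rightarrow> real) \<Rightarrow> real" where
  "tv_dist \<Omega> m1 m2 = 1 / 2 * (\<Sum>s\<in>\<Omega>. \<bar>m1 s - m2 s\<bar>)"

definition qmax :: "'a set \<Rightarrow> ('a \<Rightarrow> 'a \<Rightarrow> real) \<Rightarrow> real" where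
  "qmax S q = Max ((\<lambda>x. \<Sum>y\<in>S - {x}. q x y) ` S)"

definition configs :: "'a set \<Rightarrow> ('a \<Rightarrow> nat) set" where
  "configs S = S \<rightarrow>\<^sub>E {0, 1}"

definition all_ones :: "'a set \<Rightarrow> 'a \<Rightarrow> nat" where
  "all_ones S = (\<lambda>x\<in>S. 1)"

text \<open>
  Both mechanisms may propose a move that leaves the configuration unchanged. Such moves only
  contribute to the diagonal of \<open>voter_rate\<close>, which \<open>generator\<close> ignores.
\<close>

definition voter_rate ::
  "'a set \<Rightarrow> ('a \<Rightarrow> 'a \<Rightarrow> real) \<Rightarrow> ('a \<Rightarrow> nat) \<Rightarrow> ('a \<Rightarrow> nat) \<Rightarrow> real" where
  "voter_rate S q \<eta> \<xi> =
     (\<Sum>x\<in>S. (\<Sum>y\<in>S - {x}. if \<xi> = \<eta>(x := \<eta> y) then q x y else 0)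
           + (\<Sum>b\<in>{0, 1}. if \<xi> = \<eta>(x := b) then 1 / 2 else 0))"

lemma voter_rate_flip:
  assumes "finite S" "\<eta> \<in> configs S" "x \<in> S"
  shows "voter_rate S q \<eta> (\<eta>(x := 1 - \<eta> x)) =
    (if \<eta> x = 0 then 1 / 2 + (\<Sum>y\<in>S - {x}. q x y * real (\<eta> y))
     else 1 / 2 + (\<Sum>y\<in>S - {x}. q x y * (1 - real (\<eta> y))))"
proof -
  have val: "\<eta> z = 0 \<or> \<eta> z = 1" if "z \<in> S" for z
    using assms(2) that by (auto simp: configs_def)
  have upd: "\<eta>(x := 1 - \<eta> x) = \<eta>(z := b) \<longleftrightarrow> z = x \<and> b = 1 - \<eta> x" for z b
  proof
    assume eq: "\<eta>(x := 1 - \<eta> x) = \<eta>(z := b)"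
    have "1 - \<eta> x \<noteq> \<eta> x"
      using val[OF assms(3)] by auto
    then show "z = x \<and> b = 1 - \<eta> x"
      using fun_cong[OF eq, of x] by (auto split: if_splits)
  qed auto
  have "voter_rate S q \<eta> (\<eta>(x := 1 - \<eta> x)) =
      (\<Sum>z\<in>S. if z = x then (\<Sum>y\<in>S - {x}. if \<eta> y = 1 - \<eta> x then q x y else 0)
         + (\<Sum>b\<in>{0, 1}. if b = 1 - \<eta> x then 1 / 2 else 0) else 0)"
    unfolding voter_rate_def upd by (intro sum.cong refl) auto
  also have "\<dots> = (\<Sum>y\<in>S - {x}. if \<eta> y = 1 - \<eta> x then q x y else 0)
         + (\<Sum>b\<in>{0, 1}. if b = 1 - \<eta> x then 1 / 2 else 0)"
    using assms by simp
  also have "(\<Sum>b\<in>{0, 1}. if b = 1 - \<eta> x then 1 / 2 else 0) = (1 / 2 :: real)"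
    using val[OF assms(3)] by auto
  also have "(\<Sum>y\<in>S - {x}. if \<eta> y = 1 - \<eta> x then q x y else 0) =
      (\<Sum>y\<in>S - {x}. if \<eta> x = 0 then q x y * real (\<eta> y) else q x y * (1 - real (\<eta> y)))"
  proof (intro sum.cong refl)
    fix y assume "y \<in> S - {x}"
    then show "(if \<eta> y = 1 - \<eta> x then q x y else 0) =
      (if \<eta> x = 0 then q x y * real (\<eta> y) else q x y * (1 - real (\<eta> y)))"
      using val[OF assms(3)] val[of y] by auto
  qed
  finally show ?thesis
    by (cases "\<eta> x = 0") (simp_all only: simp_thms if_True if_False add.commute)
qed

definition voter_law ::
  "'a set \<Rightarrow> ('a \<Rightarrow> 'a \<Rightarrow> real) \<Rightarrow> ('a \<Rightarrow> nat) \<Rightarrow> real \<Rightarrow> ('a \<Rightarrow> nat) \<Rightarrow> real" where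
  "voter_law S q \<eta> t = transition (configs S) (voter_rate S q) t \<eta>"

definition voter_stationary :: "'a set \<Rightarrow> ('a \<Rightarrow> 'a \<Rightarrow> real) \<Rightarrow> ('a \<Rightarrow> nat) pmf" where
  "voter_stationary S q = (THE p. stationary (configs S) (voter_rate S q) p)"

definition voter_tv ::
  "'a set \<Rightarrow> ('a \<Rightarrow> 'a \<Rightarrow> real) \<Rightarrow> ('a \<Rightarrow> nat) \<Rightarrow> real \<Rightarrow> real" where
  "voter_tv S q \<eta> t = tv_dist (configs S) (voter_law S q \<eta> t) (pmf (voter_stationary S q))"

definition voter_tv_max :: "'a set \<Rightarrow> ('a \<Rightarrow> 'a \<Rightarrow> real) \<Rightarrow> real \<Rightarrow> real" where
  "voter_tv_max S q t = Max ((\<lambda>\<eta>. voter_tv S q \<eta> t) ` configs S)"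

definition tmix :: "'a set \<Rightarrow> ('a \<Rightarrow> 'a \<Rightarrow> real) \<Rightarrow> real \<Rightarrow> real" where
  "tmix S q \<epsilon> = Inf {t. 0 \<le> t \<and> voter_tv_max S q t \<le> \<epsilon>}"

end

theory Submission
  imports Defs "HOL-Real_Asymp.Real_Asymp"
begin

text \<open>
  Write \<open>n\<close> for the number of sites. The proof gives two estimates, valid for every \<open>n\<close> and every
  \<open>t \<ge> 0\<close>: the distance to stationarity is at most \<open>sqrt (2 * n) * exp (- t)\<close> from every initial
  configuration, and at least \<open>1 - K * exp (2 * t) / n\<close> from the configuration of all ones, where
  \<open>K\<close> depends only on the bound on the rates and on \<open>C\<close>. Both cross over at \<open>t = 1 / 2 * ln n + O(1)\<close>,
  and the three claims are read off from them.

  Upper bound. Run the voting mechanism backwards in time. The sites are grouped according to the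
  ancestor at time 0 from which they inherit their opinion, unless a rerandomization intervenes.
  Given the voting moves, different groups evolve independently, and the opinions in one group are
  obtained by broadcasting the bit of the ancestor down a tree along which the bit is rerandomized
  at rate 1. For a pair of laws \<open>p\<close>, \<open>q\<close> let \<open>h = 1 - affinity p q\<close> be the squared Hellinger distance.
  Three facts about \<open>h\<close>, seen as a cost of the pair of laws that the two values of the ancestor
  induce, suffice. Merging two groups multiplies the affinities, so costs add up at most
  (\<open>blockwise_relabel\<close>). Rerandomizing the ancestor with probability \<open>d\<close> multiplies the cost by
  \<open>(1 - d)\<^sup>2\<close> rather than by \<open>1 - d\<close> (\<open>blockwise_noise\<close>); this square is the factor
  \<open>1 / 2\<close> in the mixing time. Finally, \<open>h\<close> is jointly convex, so the mixture over the random moves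
  can be taken at the end (\<open>affinity_superadditive\<close>). At time 0 every site costs 1; hence after
  time \<open>t\<close> the total cost is at most \<open>n * exp (- 2 * t)\<close> (\<open>affinity_law\<close>), and the total variation
  distance is at most the square root of twice the cost.

  To avoid building the graphical representation, the induction runs over the powers of the
  uniformized kernel \<open>U = I + L / r\<close>, where \<open>L\<close> is the generator: one application of \<open>U\<close> to a kernel
  that factorizes over groups is a mixture of kernels of the same kind (\<open>unif_eq_mixture\<close>). The
  law at time \<open>t\<close> is a Poisson mixture of the powers of \<open>U\<close>, and \<open>r\<close> tends to infinity at the end.

  Lower bound. If \<open>p\<close> is stationary for the voting mechanism, then
  \<open>\<Phi> \<eta> = (\<Sum>x\<in>S. p x * (2 * \<eta> x - 1))\<close> is an eigenfunction of \<open>L\<close> with eigenvalue \<open>- 1\<close>: the voting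
  moves leave its mean unchanged and the rerandomizations pull it to 0. From all ones its mean at
  time \<open>t\<close> is \<open>exp (- t)\<close>, whereas its variance stays of order \<open>1 / n\<close> as \<open>p\<close> is almost uniform and
  the rates are bounded. Chebyshev's inequality separates the law at time \<open>t\<close> from the stationary
  one as long as \<open>exp (- t)\<close> is large compared to \<open>1 / sqrt n\<close> (\<open>voter_tv_ge\<close>).
\<close>

section \<open>Total variation and Hellinger affinity\<close>

lemma tv_dist_triangle: "tv_dist \<Omega> p q \<le> tv_dist \<Omega> p s + tv_dist \<Omega> s q"
proof -
  have "(\<Sum>x\<in>\<Omega>. \<bar>p x - q x\<bar>) \<le> (\<Sum>x\<in>\<Omega>. \<bar>p x - s x\<bar> + \<bar>s x - q x\<bar>)"
    by (intro sum_mono) auto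
  then show ?thesis by (simp add: tv_dist_def sum.distrib)
qed

lemma tv_dist_commute: "tv_dist \<Omega> p q = tv_dist \<Omega> q p"
  by (simp add: tv_dist_def abs_minus_commute)

lemma tv_dist_mixture_right:
  assumes p: "\<And>i. i \<in> I \<Longrightarrow> 0 \<le> w i" "sum w I = 1"
    and D: "\<And>i. i \<in> I \<Longrightarrow> tv_dist \<Omega> p (f i) \<le> D"
  shows "tv_dist \<Omega> p (\<lambda>y. \<Sum>i\<in>I. w i * f i y) \<le> D"
proof -
  have "\<bar>p y - (\<Sum>i\<in>I. w i * f i y)\<bar> \<le> (\<Sum>i\<in>I. w i * \<bar>p y - f i y\<bar>)" for y
  proof -
    have "p y - (\<Sum>i\<in>I. w i * f i y) = (\<Sum>i\<in>I. w i * (p y - f i y))"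
      using p(2) by (simp add: right_diff_distrib sum_subtractf flip: sum_distrib_right)
    then show ?thesis
      using sum_abs[of "\<lambda>i. w i * (p y - f i y)" I] p(1) by (simp add: abs_mult cong: sum.cong)
  qed
  then have "tv_dist \<Omega> p (\<lambda>y. \<Sum>i\<in>I. w i * f i y) \<le> 1 / 2 * (\<Sum>y\<in>\<Omega>. \<Sum>i\<in>I. w i * \<bar>p y - f i y\<bar>)"
    unfolding tv_dist_def by (intro mult_left_mono sum_mono) auto
  also have "\<dots> = (\<Sum>i\<in>I. w i * tv_dist \<Omega> p (f i))"
    by (subst sum.swap) (simp add: tv_dist_def sum_distrib_left ac_simps)
  also have "\<dots> \<le> (\<Sum>i\<in>I. w i * D)"
    by (intro sum_mono mult_left_mono p D)
  also have "\<dots> = D" using p(2) by (simp flip: sum_distrib_right)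
  finally show ?thesis .
qed

lemma tv_dist_ge_event:
  assumes "finite \<Omega>" "A \<subseteq> \<Omega>" "sum p \<Omega> = sum q \<Omega>"
  shows "sum p A - sum q A \<le> tv_dist \<Omega> p q"
proof -
  have "sum p A - sum q A = 1 / 2 * ((\<Sum>x\<in>A. p x - q x) + (\<Sum>x\<in>\<Omega> - A. q x - p x))"
    using assms by (simp add: sum_subtractf sum_diff)
  also have "\<dots> \<le> 1 / 2 * ((\<Sum>x\<in>A. \<bar>p x - q x\<bar>) + (\<Sum>x\<in>\<Omega> - A. \<bar>p x - q x\<bar>))"
    by (intro mult_left_mono add_mono sum_mono) auto
  also have "\<dots> = tv_dist \<Omega> p q"
    using sum.subset_diff[OF assms(2,1), of "\<lambda>x. \<bar>p x - q x\<bar>"] by (simp add: tv_dist_def)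
  finally show ?thesis .
qed

text \<open>
  The Bhattacharyya coefficient; \<open>1 - affinity \<Omega> p q\<close> is the squared
  Hellinger distance. It is preferred to total variation because it is multiplicative over
  independent coordinates.
\<close>

definition affinity :: "'s set \<Rightarrow> ('s \<Rightarrow> real) \<Rightarrow> ('s \<Rightarrow> real) \<Rightarrow> real" where
  "affinity \<Omega> p q = (\<Sum>s\<in>\<Omega>. sqrt (p s * q s))"

text \<open>
  Factor
  \<open>\<bar>p - q\<bar> = \<bar>sqrt p - sqrt q\<bar> * (sqrt p + sqrt q)\<close>
  and apply the Cauchy-Schwarz inequality.
\<close>

lemma tv_dist_le_affinity:
  assumes "\<And>s. s \<in> \<Omega> \<Longrightarrow> 0 \<le> p s" "\<And>s. s \<in> \<Omega> \<Longrightarrow> 0 \<le> q s" "sum p \<Omega> = 1" "sum q \<Omega> = 1"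
    and "1 - affinity \<Omega> p q \<le> h"
  shows "tv_dist \<Omega> p q \<le> sqrt (2 * h)"
proof -
  let ?b = "affinity \<Omega> p q"
  have fin: "finite \<Omega>" using assms(3) by (metis sum.infinite zero_neq_one)
  have sq: "(sqrt (p s) - sqrt (q s))\<^sup>2 = p s + q s - 2 * sqrt (p s * q s)"
    "(sqrt (p s) + sqrt (q s))\<^sup>2 = p s + q s + 2 * sqrt (p s * q s)"
    "\<bar>p s - q s\<bar> = \<bar>sqrt (p s) - sqrt (q s)\<bar> * \<bar>sqrt (p s) + sqrt (q s)\<bar>" if "s \<in> \<Omega>" for s
  proof -
    show "(sqrt (p s) - sqrt (q s))\<^sup>2 = p s + q s - 2 * sqrt (p s * q s)"
      "(sqrt (p s) + sqrt (q s))\<^sup>2 = p s + q s + 2 * sqrt (p s * q s)"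
      using assms(1,2)[OF that] by (simp_all add: power2_diff power2_sum real_sqrt_mult)
    have "p s - q s = (sqrt (p s) - sqrt (q s)) * (sqrt (p s) + sqrt (q s))"
      using assms(1,2)[OF that] by (simp add: algebra_simps)
    then show "\<bar>p s - q s\<bar> = \<bar>sqrt (p s) - sqrt (q s)\<bar> * \<bar>sqrt (p s) + sqrt (q s)\<bar>"
      by (metis abs_mult)
  qed
  have "(\<Sum>s\<in>\<Omega>. \<bar>p s - q s\<bar>) = (\<Sum>s\<in>\<Omega>. \<bar>sqrt (p s) - sqrt (q s)\<bar> * \<bar>sqrt (p s) + sqrt (q s)\<bar>)"
    by (intro sum.cong sq refl)
  also have "\<dots> \<le> L2_set (\<lambda>s. sqrt (p s) - sqrt (q s)) \<Omega> * L2_set (\<lambda>s. sqrt (p s) + sqrt (q s)) \<Omega>"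
    by (rule L2_set_mult_ineq)
  also have "L2_set (\<lambda>s. sqrt (p s) - sqrt (q s)) \<Omega> = sqrt (2 - 2 * ?b)"
    using assms(3,4) by (simp add: L2_set_def sq sum.distrib sum_subtractf affinity_def sum_distrib_left cong: sum.cong)
  also have "L2_set (\<lambda>s. sqrt (p s) + sqrt (q s)) \<Omega> = sqrt (2 + 2 * ?b)"
    using assms(3,4) by (simp add: L2_set_def sq sum.distrib affinity_def sum_distrib_left cong: sum.cong)
  finally have le: "(\<Sum>s\<in>\<Omega>. \<bar>p s - q s\<bar>) \<le> sqrt ((2 - 2 * ?b) * (2 + 2 * ?b))"
    by (simp add: real_sqrt_mult)
  have "(2 - 2 * ?b) * (2 + 2 * ?b) \<le> 8 * (1 - ?b)"
    using zero_le_power2[of "1 - ?b"] by (simp add: power2_eq_square algebra_simps)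
  also have "\<dots> \<le> 2\<^sup>2 * (2 * h)" using assms(5) by simp
  finally have "sqrt ((2 - 2 * ?b) * (2 + 2 * ?b)) \<le> 2 * sqrt (2 * h)"
    by (metis real_sqrt_le_mono real_sqrt_mult real_sqrt_abs abs_numeral)
  with le show ?thesis by (simp add: tv_dist_def)
qed

text \<open>
  The Cauchy-Schwarz inequality at every state. Total weight below 1 is allowed in order to cover
  the partial sums of an infinite mixture.
\<close>

lemma affinity_superadditive:
  assumes "finite I" "\<And>i. i \<in> I \<Longrightarrow> 0 \<le> w i"
    and "\<And>i s. i \<in> I \<Longrightarrow> s \<in> \<Omega> \<Longrightarrow> 0 \<le> p i s" "\<And>i s. i \<in> I \<Longrightarrow> s \<in> \<Omega> \<Longrightarrow> 0 \<le> q i s"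
  shows "(\<Sum>i\<in>I. w i * affinity \<Omega> (p i) (q i))
    \<le> affinity \<Omega> (\<lambda>s. \<Sum>i\<in>I. w i * p i s) (\<lambda>s. \<Sum>i\<in>I. w i * q i s)"
proof -
  have "(\<Sum>i\<in>I. w i * sqrt (p i s * q i s)) \<le> sqrt ((\<Sum>i\<in>I. w i * p i s) * (\<Sum>i\<in>I. w i * q i s))"
    if s: "s \<in> \<Omega>" for s
  proof -
    have "(\<Sum>i\<in>I. w i * sqrt (p i s * q i s)) = (\<Sum>i\<in>I. \<bar>sqrt (w i * p i s)\<bar> * \<bar>sqrt (w i * q i s)\<bar>)"
      using assms s by (intro sum.cong) (auto simp: real_sqrt_mult)
    also have "\<dots> \<le> L2_set (\<lambda>i. sqrt (w i * p i s)) I * L2_set (\<lambda>i. sqrt (w i * q i s)) I"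
      by (rule L2_set_mult_ineq)
    also have "\<dots> = sqrt ((\<Sum>i\<in>I. w i * p i s) * (\<Sum>i\<in>I. w i * q i s))"
    proof -
      have "(\<Sum>i\<in>I. (sqrt (w i * p i s))\<^sup>2) = (\<Sum>i\<in>I. w i * p i s)"
        "(\<Sum>i\<in>I. (sqrt (w i * q i s))\<^sup>2) = (\<Sum>i\<in>I. w i * q i s)"
        using assms s by simp_all
      then show ?thesis by (simp add: L2_set_def flip: real_sqrt_mult)
    qed
    finally show ?thesis .
  qed
  then have "(\<Sum>s\<in>\<Omega>. \<Sum>i\<in>I. w i * sqrt (p i s * q i s))
     \<le> affinity \<Omega> (\<lambda>s. \<Sum>i\<in>I. w i * p i s) (\<lambda>s. \<Sum>i\<in>I. w i * q i s)"
    unfolding affinity_def by (rule sum_mono)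
  moreover have "(\<Sum>s\<in>\<Omega>. \<Sum>i\<in>I. w i * sqrt (p i s * q i s)) = (\<Sum>i\<in>I. w i * affinity \<Omega> (p i) (q i))"
    by (subst sum.swap) (simp add: affinity_def sum_distrib_left)
  ultimately show ?thesis by simp
qed

lemma affinity_nonneg:
  "(\<And>s. s \<in> \<Omega> \<Longrightarrow> 0 \<le> p s) \<Longrightarrow> (\<And>s. s \<in> \<Omega> \<Longrightarrow> 0 \<le> q s) \<Longrightarrow> 0 \<le> affinity \<Omega> p q"
  unfolding affinity_def by (intro sum_nonneg) simp

lemma affinity_le_1:
  assumes "\<And>s. s \<in> \<Omega> \<Longrightarrow> 0 \<le> p s" "\<And>s. s \<in> \<Omega> \<Longrightarrow> 0 \<le> q s" "sum p \<Omega> = 1" "sum q \<Omega> = 1"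
  shows "affinity \<Omega> p q \<le> 1"
proof -
  have "affinity \<Omega> p q \<le> (\<Sum>s\<in>\<Omega>. (p s + q s) / 2)"
    unfolding affinity_def using assms by (intro sum_mono arith_geo_mean_sqrt) auto
  also have "\<dots> = 1" using assms by (simp add: sum.distrib flip: sum_divide_distrib)
  finally show ?thesis .
qed

lemma affinity_commute: "affinity \<Omega> p q = affinity \<Omega> q p"
  by (simp add: affinity_def mult.commute)

lemma affinity_refl:
  assumes "\<And>s. s \<in> \<Omega> \<Longrightarrow> 0 \<le> p s" "sum p \<Omega> = 1"
  shows "affinity \<Omega> p p = 1"
  using assms by (simp add: affinity_def cong: sum.cong)

text \<open>
  Put \<open>m = (p + q) / 2\<close>, \<open>s = sqrt (p * q)\<close> and
  \<open>e = 1 - d\<close>. Mixing both values with their mean shrinks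
  \<open>m\<^sup>2 - s\<^sup>2\<close>, the square of their half difference, by
  \<open>e\<^sup>2\<close>, so the new product is the convex combination of
  \<open>m\<^sup>2\<close> and \<open>s\<^sup>2\<close> with weight \<open>e\<^sup>2\<close> on
  \<open>s\<^sup>2\<close>; concavity of the square root does the rest.
\<close>

lemma sqrt_noise:
  fixes p q :: real
  assumes "0 \<le> p" "0 \<le> q" "0 \<le> d" "d \<le> 1"
  shows "(1 - (1 - d)\<^sup>2) * ((p + q) / 2) + (1 - d)\<^sup>2 * sqrt (p * q)
    \<le> sqrt (((1 - d) * p + d / 2 * (p + q)) * ((1 - d) * q + d / 2 * (p + q)))"
proof (rule real_le_rsqrt)
  let ?m = "(p + q) / 2" and ?s = "sqrt (p * q)" and ?r = "(1 - d)\<^sup>2"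
  have r: "0 \<le> ?r" "?r \<le> 1" using assms by (auto simp: power_le_one)
  have "((1 - ?r) * ?m + ?r * ?s)\<^sup>2 = (1 - ?r) * ?m\<^sup>2 + ?r * ?s\<^sup>2 - ?r * (1 - ?r) * (?m - ?s)\<^sup>2"
  proof -
    have "((1 - r) * m + r * s)\<^sup>2 = (1 - r) * m\<^sup>2 + r * s\<^sup>2 - r * (1 - r) * (m - s)\<^sup>2" for r m s :: real
      by (simp add: power2_eq_square algebra_simps)
    then show ?thesis .
  qed
  also have "\<dots> \<le> (1 - ?r) * ?m\<^sup>2 + ?r * ?s\<^sup>2"
    using r by simp
  also have "?s\<^sup>2 = p * q" using assms by simp
  also have "(1 - ?r) * ?m\<^sup>2 + ?r * (p * q) = ((1 - d) * p + d / 2 * (p + q)) * ((1 - d) * q + d / 2 * (p + q))"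
  proof -
    have "(1 - e\<^sup>2) * ((p + q) / 2)\<^sup>2 + e\<^sup>2 * (p * q)
      = (e * p + (1 - e) / 2 * (p + q)) * (e * q + (1 - e) / 2 * (p + q))" for e
      by (simp add: power2_eq_square field_simps)
    from this[of "1 - d"] show ?thesis by simp
  qed
  finally show "((1 - ?r) * ?m + ?r * ?s)\<^sup>2 \<le> \<dots>" .
qed

text \<open>
  Confusing two hypotheses with probability \<open>d\<close> shrinks their squared Hellinger
  distance quadratically in \<open>1 - d\<close>. Total variation would shrink only linearly,
  and the mixing time obtained in this way would be too large by a factor of 2.
\<close>

lemma affinity_noise:
  assumes "\<And>s. s \<in> \<Omega> \<Longrightarrow> 0 \<le> p s" "\<And>s. s \<in> \<Omega> \<Longrightarrow> 0 \<le> q s" "sum p \<Omega> = 1" "sum q \<Omega> = 1"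
    and "0 \<le> d" "d \<le> 1"
  shows "1 - affinity \<Omega> (\<lambda>s. (1 - d) * p s + d / 2 * (p s + q s)) (\<lambda>s. (1 - d) * q s + d / 2 * (p s + q s))
    \<le> (1 - d)\<^sup>2 * (1 - affinity \<Omega> p q)"
proof -
  have "(\<Sum>s\<in>\<Omega>. (1 - (1 - d)\<^sup>2) * ((p s + q s) / 2) + (1 - d)\<^sup>2 * sqrt (p s * q s))
    \<le> affinity \<Omega> (\<lambda>s. (1 - d) * p s + d / 2 * (p s + q s)) (\<lambda>s. (1 - d) * q s + d / 2 * (p s + q s))"
    unfolding affinity_def using assms by (intro sum_mono sqrt_noise) auto
  moreover have mean: "(\<Sum>s\<in>\<Omega>. (p s + q s) / 2) = 1"
    using assms by (simp add: sum.distrib flip: sum_divide_distrib)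
  have "(\<Sum>s\<in>\<Omega>. (1 - (1 - d)\<^sup>2) * ((p s + q s) / 2) + (1 - d)\<^sup>2 * sqrt (p s * q s))
    = (1 - (1 - d)\<^sup>2) + (1 - d)\<^sup>2 * affinity \<Omega> p q"
    unfolding sum.distrib sum_distrib_left[symmetric] mean affinity_def by simp
  ultimately show ?thesis
    by (simp only: right_diff_distrib mult_1_right)
qed

section \<open>Finite Markov chains and uniformization\<close>

text \<open>
  Functions on the state space are acted on by the generator as operators, so that matrix powers
  become iterates. All functions are total, but only their values on \<open>\<Omega>\<close>
  matter.
\<close>

locale rates =
  fixes \<Omega> :: "'s set" and r :: "'s \<Rightarrow> 's \<Rightarrow> real"
  assumes finite_states: "finite \<Omega>"
    and rates_nonneg: "\<And>x y. x \<in> \<Omega> \<Longrightarrow> y \<in> \<Omega> \<Longrightarrow> x \<noteq> y \<Longrightarrow> 0 \<le> r x y"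
begin

definition gen :: "('s \<Rightarrow> real) \<Rightarrow> 's \<Rightarrow> real" where
  "gen F x = (\<Sum>y\<in>\<Omega>. generator \<Omega> r x y * F y)"

definition flow :: "real \<Rightarrow> ('s \<Rightarrow> real) \<Rightarrow> 's \<Rightarrow> real" where
  "flow t F x = (\<Sum>k. t ^ k / fact k * (gen ^^ k) F x)"

text \<open>
  One step of the discrete chain whose steps are taken at the times of a Poisson process of rate
  \<open>c\<close>.
\<close>

definition unif :: "real \<Rightarrow> ('s \<Rightarrow> real) \<Rightarrow> 's \<Rightarrow> real" where
  "unif c F x = F x + gen F x / c"

lemma gen_eq:
  assumes "x \<in> \<Omega>"
  shows "gen F x = (\<Sum>y\<in>\<Omega> - {x}. r x y * (F y - F x))"
proof -
  have "gen F x = generator \<Omega> r x x * F x + (\<Sum>y\<in>\<Omega> - {x}. generator \<Omega> r x y * F y)"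
    unfolding gen_def using finite_states assms by (rule sum.remove)
  also have "(\<Sum>y\<in>\<Omega> - {x}. generator \<Omega> r x y * F y) = (\<Sum>y\<in>\<Omega> - {x}. r x y * F y)"
    by (intro sum.cong) (auto simp: generator_def)
  finally show ?thesis
    by (simp add: generator_def algebra_simps sum_subtractf sum_distrib_left)
qed

lemma gen_cong: "(\<And>y. y \<in> \<Omega> \<Longrightarrow> F y = G y) \<Longrightarrow> gen F = gen G"
  by (auto simp: gen_def fun_eq_iff intro!: sum.cong)

lemma gen_sum: "gen (\<lambda>y. \<Sum>i\<in>I. w i * F i y) x = (\<Sum>i\<in>I. w i * gen (F i) x)"
  unfolding gen_def sum_distrib_left by (subst sum.swap) (simp add: ac_simps)

lemma unif_sum: "unif c (\<lambda>y. \<Sum>i\<in>I. w i * F i y) x = (\<Sum>i\<in>I. w i * unif c (F i) x)"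
  by (simp add: unif_def gen_sum sum_divide_distrib sum.distrib distrib_left)

lemma unif_cong: "(\<And>y. y \<in> \<Omega> \<Longrightarrow> F y = G y) \<Longrightarrow> x \<in> \<Omega> \<Longrightarrow> unif c F x = unif c G x"
  using gen_cong[of F G] by (simp add: unif_def)

lemma unif_pow_cong:
  "(\<And>y. y \<in> \<Omega> \<Longrightarrow> F y = G y) \<Longrightarrow> x \<in> \<Omega> \<Longrightarrow> (unif c ^^ m) F x = (unif c ^^ m) G x"
  by (induction m arbitrary: x) (auto intro: unif_cong)

lemma gen_pow_sum: "(gen ^^ m) (\<lambda>y. \<Sum>i\<in>I. w i * F i y) = (\<lambda>x. \<Sum>i\<in>I. w i * (gen ^^ m) (F i) x)"
  by (induction m) (auto simp: gen_sum)

lemma unif_pow_sum: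
  "(unif c ^^ m) (\<lambda>y. \<Sum>i\<in>I. w i * F i y) = (\<lambda>x. \<Sum>i\<in>I. w i * (unif c ^^ m) (F i) x)"
  by (induction m) (auto simp: unif_sum)

lemma gen_pow_eq:
  "x \<in> \<Omega> \<Longrightarrow> (\<Sum>y\<in>\<Omega>. generator_power \<Omega> r k x y * F y) = (gen ^^ k) F x"
proof (induction k arbitrary: x)
  case 0
  have "(\<Sum>y\<in>\<Omega>. generator_power \<Omega> r 0 x y * F y) = (\<Sum>y\<in>\<Omega>. if y = x then F y else 0)"
    by (intro sum.cong) auto
  then show ?case using 0 finite_states by simp
next
  case (Suc k)
  have "(\<Sum>y\<in>\<Omega>. generator_power \<Omega> r (Suc k) x y * F y)
      = (\<Sum>z\<in>\<Omega>. generator \<Omega> r x z * (\<Sum>y\<in>\<Omega>. generator_power \<Omega> r k z y * F y))"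
    by (simp add: sum_distrib_right sum_distrib_left mult.assoc) (rule sum.swap)
  also have "\<dots> = gen ((gen ^^ k) F) x"
    unfolding gen_def[of "(gen ^^ k) F"] by (intro sum.cong) (auto simp: Suc.IH)
  finally show ?case by simp
qed

text \<open>
  A crude geometric bound, just enough to make the exponential series converge absolutely.
\<close>

lemma gen_pow_bound:
  obtains M B where "\<And>k x. x \<in> \<Omega> \<Longrightarrow> \<bar>(gen ^^ k) F x\<bar> \<le> M ^ k * B" "0 \<le> M" "0 \<le> B"
proof -
  define M where "M = (\<Sum>x\<in>\<Omega>. \<Sum>y\<in>\<Omega>. \<bar>generator \<Omega> r x y\<bar>)"
  define B where "B = (\<Sum>x\<in>\<Omega>. \<bar>F x\<bar>)"
  have B0: "0 \<le> B" and M0: "0 \<le> M" by (auto simp: B_def M_def intro!: sum_nonneg)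
  have "\<bar>(gen ^^ k) F x\<bar> \<le> M ^ k * B" if "x \<in> \<Omega>" for k x
    using that
  proof (induction k arbitrary: x)
    case 0
    then show ?case using finite_states by (auto simp: B_def intro: member_le_sum)
  next
    case (Suc k)
    have "\<bar>(gen ^^ Suc k) F x\<bar> \<le> (\<Sum>y\<in>\<Omega>. \<bar>generator \<Omega> r x y * (gen ^^ k) F y\<bar>)"
      by (simp add: gen_def sum_abs)
    also have "\<dots> \<le> (\<Sum>y\<in>\<Omega>. \<bar>generator \<Omega> r x y\<bar> * (M ^ k * B))"
      using Suc.IH by (intro sum_mono) (auto simp: abs_mult intro!: mult_left_mono)
    also have "\<dots> = (\<Sum>y\<in>\<Omega>. \<bar>generator \<Omega> r x y\<bar>) * (M ^ k * B)"
      by (simp add: sum_distrib_right)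
    also have "\<dots> \<le> M * (M ^ k * B)"
      using Suc.prems finite_states M0 B0 unfolding M_def
      by (intro mult_right_mono member_le_sum[of x \<Omega> "\<lambda>x. \<Sum>y\<in>\<Omega>. \<bar>generator \<Omega> r x y\<bar>"])
        (auto intro: sum_nonneg)
    finally show ?case by (simp add: mult.assoc)
  qed
  then show ?thesis using that M0 B0 by blast
qed

lemma summable_flow:
  assumes "x \<in> \<Omega>"
  shows "summable (\<lambda>k. norm (t ^ k / fact k * (gen ^^ k) F x))"
proof -
  obtain M B where MB: "\<And>k x. x \<in> \<Omega> \<Longrightarrow> \<bar>(gen ^^ k) F x\<bar> \<le> M ^ k * B" "0 \<le> M" "0 \<le> B"
    using gen_pow_bound[of F] by blast
  have "summable (\<lambda>k. (\<bar>t\<bar> * M) ^ k /\<^sub>R fact k * B)"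
    by (intro summable_mult2 summable_exp_generic)
  moreover have "norm (norm (t ^ k / fact k * (gen ^^ k) F x)) \<le> (\<bar>t\<bar> * M) ^ k /\<^sub>R fact k * B" for k
  proof -
    have "\<bar>t\<bar> ^ k / fact k * \<bar>(gen ^^ k) F x\<bar> \<le> \<bar>t\<bar> ^ k / fact k * (M ^ k * B)"
      by (intro mult_left_mono MB assms) auto
    then show ?thesis by (simp add: abs_mult power_abs power_mult_distrib divide_inverse ac_simps)
  qed
  ultimately show ?thesis by (rule summable_comparison_test'[where N=0])
qed

lemma flow_sums:
  "x \<in> \<Omega> \<Longrightarrow> (\<lambda>k. t ^ k / fact k * (gen ^^ k) F x) sums flow t F x"
  unfolding flow_def using summable_flow[of x t F]
  by (intro summable_sums) (rule summable_norm_cancel)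

lemma transition_eq_flow:
  assumes "x \<in> \<Omega>" "y \<in> \<Omega>"
  shows "transition \<Omega> r t x y = flow t (\<lambda>z. of_bool (z = y)) x"
proof -
  have "generator_power \<Omega> r k x y = (gen ^^ k) (\<lambda>z. of_bool (z = y)) x" for k
    using gen_pow_eq[OF assms(1), of k "\<lambda>z. of_bool (z = y)"] finite_states assms(2)
    by (simp add: sum.remove[of \<Omega> y])
  then show ?thesis by (simp add: transition_def flow_def)
qed

lemma flow_sum:
  assumes "x \<in> \<Omega>"
  shows "flow t (\<lambda>y. \<Sum>i\<in>I. w i * F i y) x = (\<Sum>i\<in>I. w i * flow t (F i) x)"
proof -
  have "(\<lambda>k. \<Sum>i\<in>I. w i * (t ^ k / fact k * (gen ^^ k) (F i) x)) sums (\<Sum>i\<in>I. w i * flow t (F i) x)"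
    by (intro sums_sum sums_mult flow_sums assms)
  moreover have "(\<lambda>k. \<Sum>i\<in>I. w i * (t ^ k / fact k * (gen ^^ k) (F i) x))
     = (\<lambda>k. t ^ k / fact k * (gen ^^ k) (\<lambda>y. \<Sum>i\<in>I. w i * F i y) x)"
    by (simp add: gen_pow_sum sum_distrib_left ac_simps)
  ultimately show ?thesis
    using sums_unique2[OF _ flow_sums[OF assms, of t "\<lambda>y. \<Sum>i\<in>I. w i * F i y"]] by simp
qed

lemma gen_pow_cong:
  "(\<And>y. y \<in> \<Omega> \<Longrightarrow> F y = G y) \<Longrightarrow> x \<in> \<Omega> \<Longrightarrow> (gen ^^ k) F x = (gen ^^ k) G x"
proof (induction k arbitrary: x)
  case (Suc k)
  then show ?case using gen_cong[of "(gen ^^ k) F" "(gen ^^ k) G"] by simp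
qed simp

lemma flow_cong:
  "(\<And>y. y \<in> \<Omega> \<Longrightarrow> F y = G y) \<Longrightarrow> x \<in> \<Omega> \<Longrightarrow> flow t F x = flow t G x"
  unfolding flow_def using gen_pow_cong[of F G x] by simp

lemma point_decomposition:
  fixes F :: "'s \<Rightarrow> real"
  shows "y \<in> \<Omega> \<Longrightarrow> F y = (\<Sum>z\<in>\<Omega>. F z * of_bool (y = z))"
  using finite_states by (simp add: sum.remove[of \<Omega> y] sum.neutral)

lemma expectation_transition:
  assumes "x \<in> \<Omega>"
  shows "(\<Sum>y\<in>\<Omega>. transition \<Omega> r t x y * F y) = flow t F x"
proof -
  have "flow t F x = flow t (\<lambda>y. \<Sum>z\<in>\<Omega>. F z * of_bool (y = z)) x"
    using assms by (intro flow_cong point_decomposition)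
  also have "\<dots> = (\<Sum>z\<in>\<Omega>. F z * flow t (\<lambda>y. of_bool (y = z)) x)"
    by (rule flow_sum[OF assms])
  finally show ?thesis
    by (simp add: transition_eq_flow assms ac_simps cong: sum.cong)
qed

lemma unif_pow_binomial:
  assumes "c \<noteq> 0"
  shows "c ^ m * (unif c ^^ m) F x = (\<Sum>j\<le>m. real (m choose j) * c ^ (m - j) * (gen ^^ j) F x)"
proof (induction m arbitrary: x)
  case 0
  show ?case by simp
next
  case (Suc m)
  let ?a = "\<lambda>j. (gen ^^ j) F x"
  have lin: "c ^ m * gen ((unif c ^^ m) F) x = gen (\<lambda>y. c ^ m * (unif c ^^ m) F y) x"
    by (simp add: gen_def sum_distrib_left ac_simps)
  have "c ^ Suc m * (unif c ^^ Suc m) F x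
      = c * (c ^ m * (unif c ^^ m) F x) + c ^ m * gen ((unif c ^^ m) F) x"
    using assms unif_def[of c "(unif c ^^ m) F" x] by (simp add: distrib_left)
  also have "\<dots> = c * (\<Sum>j\<le>m. real (m choose j) * c ^ (m - j) * ?a j)
      + (\<Sum>j\<le>m. real (m choose j) * c ^ (m - j) * ?a (Suc j))"
    by (simp only: lin Suc.IH gen_sum funpow.simps o_apply)
  also have "\<dots> = (\<Sum>j\<le>Suc m. real (Suc m choose j) * c ^ (Suc m - j) * ?a j)"
  proof -
    have "(\<Sum>j\<le>Suc m. real (Suc m choose j) * c ^ (Suc m - j) * ?a j)
       = c ^ Suc m * ?a 0 + (\<Sum>j\<le>m. real (Suc m choose Suc j) * c ^ (m - j) * ?a (Suc j))"
      by (subst sum.atMost_Suc_shift) simp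
    also have "(\<Sum>j\<le>m. real (Suc m choose Suc j) * c ^ (m - j) * ?a (Suc j))
       = (\<Sum>j\<le>m. real (m choose j) * c ^ (m - j) * ?a (Suc j))
        + (\<Sum>j\<le>m. real (m choose Suc j) * c ^ (m - j) * ?a (Suc j))"
      by (simp add: sum.distrib[symmetric] distrib_right)
    also have "c ^ Suc m * ?a 0 + (\<dots>) = (\<Sum>j\<le>m. real (m choose j) * c ^ (m - j) * ?a (Suc j))
       + (\<Sum>j\<le>Suc m. real (m choose j) * c ^ (Suc m - j) * ?a j)"
      by (simp only: sum.atMost_Suc_shift[of "\<lambda>j. real (m choose j) * c ^ (Suc m - j) * ?a j"]) simp
    also have "(\<Sum>j\<le>Suc m. real (m choose j) * c ^ (Suc m - j) * ?a j)
       = c * (\<Sum>j\<le>m. real (m choose j) * c ^ (m - j) * ?a j)"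
      unfolding sum.atMost_Suc sum_distrib_left by (simp add: Suc_diff_le mult.assoc mult.left_commute)
    finally show ?thesis by linarith
  qed
  finally show ?case .
qed

text \<open>
  This is
  \<open>exp (t * L) = exp (- c * t) * exp (c * t * (I + L / c))\<close>,
  proved one entry at a time by multiplying the exponential series of the scalar
  \<open>c * t\<close> with that of \<open>t * L\<close>. It turns statements about the
  semigroup into inductions over the powers of one matrix that is nonnegative for large
  \<open>c\<close>.
\<close>

lemma uniformization:
  assumes "c > 0" "x \<in> \<Omega>"
  shows "(\<lambda>m. exp (- (c * t)) * (c * t) ^ m / fact m * (unif c ^^ m) F x) sums flow t F x"
proof -
  let ?a = "\<lambda>j. (gen ^^ j) F x"
  have "(\<lambda>m. \<Sum>j\<le>m. t ^ j / fact j * ?a j * ((c * t) ^ (m - j) / fact (m - j)))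
      sums ((\<Sum>j. t ^ j / fact j * ?a j) * (\<Sum>j. (c * t) ^ j / fact j))"
    using summable_norm_exp[of "c * t"]
    by (intro Cauchy_product_sums summable_flow assms) (simp add: divide_inverse mult.commute)
  moreover have "(\<Sum>j. (c * t) ^ j / fact j) = exp (c * t)"
    by (simp add: exp_def divide_inverse mult.commute)
  moreover have "(\<Sum>j\<le>m. t ^ j / fact j * ?a j * ((c * t) ^ (m - j) / fact (m - j)))
      = (c * t) ^ m / fact m * (unif c ^^ m) F x" for m
  proof -
    have "(c * t) ^ m / fact m * (unif c ^^ m) F x = t ^ m / fact m * (c ^ m * (unif c ^^ m) F x)"
      by (simp add: power_mult_distrib)
    also have "\<dots> = (\<Sum>j\<le>m. t ^ m / fact m * (real (m choose j) * c ^ (m - j) * ?a j))"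
      using assms(1) by (subst unif_pow_binomial) (simp_all add: sum_distrib_left)
    also have "\<dots> = (\<Sum>j\<le>m. t ^ j / fact j * ?a j * ((c * t) ^ (m - j) / fact (m - j)))"
    proof (intro sum.cong refl)
      fix j assume "j \<in> {..m}"
      then have j: "j \<le> m" by simp
      have "real (m choose j) = fact m / (fact j * fact (m - j))"
        using j by (rule binomial_fact)
      moreover have "t ^ m = t ^ j * t ^ (m - j)"
        using j by (simp flip: power_add)
      ultimately show "t ^ m / fact m * (real (m choose j) * c ^ (m - j) * ?a j)
          = t ^ j / fact j * ?a j * ((c * t) ^ (m - j) / fact (m - j))"
        by (simp add: power_mult_distrib)
    qed
    finally show ?thesis by simp
  qed
  ultimately have "(\<lambda>m. (c * t) ^ m / fact m * (unif c ^^ m) F x) sums (flow t F x * exp (c * t))"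
    by (simp add: flow_def)
  from sums_mult[OF this, of "exp (- (c * t))"] show ?thesis
    by (simp add: exp_minus mult.assoc field_simps)
qed

definition uniformizing :: "real \<Rightarrow> bool" where
  "uniformizing c \<longleftrightarrow> 0 < c \<and> (\<forall>x\<in>\<Omega>. (\<Sum>z\<in>\<Omega> - {x}. r x z) \<le> c)"

lemma uniformizing_exists: "\<exists>c. uniformizing c"
proof -
  define c where "c = 1 + (\<Sum>x\<in>\<Omega>. \<Sum>z\<in>\<Omega> - {x}. r x z)"
  have nn: "0 \<le> (\<Sum>z\<in>\<Omega> - {x}. r x z)" if "x \<in> \<Omega>" for x
    using that by (intro sum_nonneg rates_nonneg) auto
  have "(\<Sum>z\<in>\<Omega> - {x}. r x z) \<le> c" if "x \<in> \<Omega>" for x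
    using member_le_sum[OF that, of "\<lambda>x. \<Sum>z\<in>\<Omega> - {x}. r x z"] nn finite_states
    by (simp add: c_def)
  moreover have "c > 0" using nn by (simp add: c_def sum_nonneg add_pos_nonneg)
  ultimately show ?thesis unfolding uniformizing_def by blast
qed

lemma unif_eq:
  assumes "x \<in> \<Omega>" "c \<noteq> 0"
  shows "unif c F x = (1 - (\<Sum>z\<in>\<Omega> - {x}. r x z) / c) * F x + (\<Sum>y\<in>\<Omega> - {x}. r x y / c * F y)"
proof -
  have "gen F x = (\<Sum>y\<in>\<Omega> - {x}. r x y * F y) - (\<Sum>y\<in>\<Omega> - {x}. r x y) * F x"
    using assms(1) by (simp add: gen_eq right_diff_distrib sum_subtractf sum_distrib_right)
  then have "gen F x / c = (\<Sum>y\<in>\<Omega> - {x}. r x y / c * F y) - (\<Sum>y\<in>\<Omega> - {x}. r x y) / c * F x"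
    by (simp add: diff_divide_distrib flip: sum_divide_distrib)
  then show ?thesis by (simp add: unif_def left_diff_distrib)
qed

lemma unif_mono:
  assumes "uniformizing c" "\<And>y. y \<in> \<Omega> \<Longrightarrow> F y \<le> G y" "x \<in> \<Omega>"
  shows "unif c F x \<le> unif c G x"
proof -
  have c: "c > 0" "(\<Sum>z\<in>\<Omega> - {x}. r x z) \<le> c" using assms by (auto simp: uniformizing_def)
  show ?thesis
    unfolding unif_eq[OF assms(3) less_imp_neq[OF c(1), symmetric]]
    using c assms(2,3) rates_nonneg
    by (intro add_mono mult_left_mono sum_mono divide_nonneg_pos) auto
qed

lemma unif_pow_mono:
  "uniformizing c \<Longrightarrow> (\<And>y. y \<in> \<Omega> \<Longrightarrow> F y \<le> G y) \<Longrightarrow> x \<in> \<Omega> \<Longrightarrow> (unif c ^^ m) F x \<le> (unif c ^^ m) G x"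
  by (induction m arbitrary: x) (auto intro: unif_mono)

lemma gen_const: "x \<in> \<Omega> \<Longrightarrow> gen (\<lambda>_. a) x = 0"
  by (simp add: gen_eq)

lemma unif_pow_const: "x \<in> \<Omega> \<Longrightarrow> (unif c ^^ m) (\<lambda>_. a) x = a"
proof (induction m arbitrary: x)
  case (Suc m)
  have "(unif c ^^ Suc m) (\<lambda>_. a) x = unif c (\<lambda>_. a) x"
    using unif_cong[of "(unif c ^^ m) (\<lambda>_. a)" "\<lambda>_. a"] Suc by simp
  also have "\<dots> = a" using Suc.prems by (simp add: unif_def[of c "\<lambda>_. a"] gen_const)
  finally show ?case .
qed simp

lemma unif_pow_nonneg:
  "uniformizing c \<Longrightarrow> (\<And>y. y \<in> \<Omega> \<Longrightarrow> 0 \<le> F y) \<Longrightarrow> x \<in> \<Omega> \<Longrightarrow> 0 \<le> (unif c ^^ m) F x"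
  using unif_pow_mono[of c "\<lambda>_. 0" F x m] by (simp add: unif_pow_const)

lemma flow_nonneg:
  assumes "\<And>y. y \<in> \<Omega> \<Longrightarrow> 0 \<le> F y" "x \<in> \<Omega>" "0 \<le> t"
  shows "0 \<le> flow t F x"
proof -
  obtain c where c: "uniformizing c" using uniformizing_exists by blast
  then have "c > 0" by (simp add: uniformizing_def)
  have "0 \<le> (\<Sum>m. exp (- (c * t)) * (c * t) ^ m / fact m * (unif c ^^ m) F x)"
    using uniformization[OF \<open>c > 0\<close> assms(2), of t F] unif_pow_nonneg[OF c assms(1,2)] \<open>c > 0\<close> assms(3)
    by (intro suminf_nonneg) (auto simp: sums_iff)
  then show ?thesis
    using uniformization[OF \<open>c > 0\<close> assms(2), of t F] by (simp add: sums_iff)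
qed

lemma gen_pow_eigen:
  assumes "\<And>y. y \<in> \<Omega> \<Longrightarrow> gen F y = a * F y" "x \<in> \<Omega>"
  shows "(gen ^^ k) F x = a ^ k * F x"
  using assms(2)
proof (induction k arbitrary: x)
  case (Suc k)
  have "(gen ^^ Suc k) F x = gen (\<lambda>y. a ^ k * F y) x"
    using gen_cong[of "(gen ^^ k) F" "\<lambda>y. a ^ k * F y"] Suc by simp
  also have "\<dots> = a ^ k * gen F x" by (simp add: gen_def sum_distrib_left ac_simps)
  finally show ?case using Suc assms(1) by simp
qed simp

lemma flow_eigen:
  assumes "\<And>y. y \<in> \<Omega> \<Longrightarrow> gen F y = a * F y" "x \<in> \<Omega>"
  shows "flow t F x = exp (a * t) * F x"
proof -
  have "(\<lambda>k. (a * t) ^ k /\<^sub>R fact k * F x) sums (exp (a * t) * F x)"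
    by (intro sums_mult2 exp_converges)
  moreover have "(\<lambda>k. (a * t) ^ k /\<^sub>R fact k * F x) = (\<lambda>k. t ^ k / fact k * (gen ^^ k) F x)"
    using gen_pow_eigen[OF assms] by (simp add: fun_eq_iff power_mult_distrib divide_inverse ac_simps)
  ultimately show ?thesis using flow_sums[OF assms(2), of t F] sums_unique2 by metis
qed

lemma flow_const: "x \<in> \<Omega> \<Longrightarrow> flow t (\<lambda>_. a) x = a"
  using flow_eigen[of "\<lambda>_. a" 0 x t] by (simp add: gen_const)

text \<open>
  The differential inequality \<open>m' \<le> - 2 * m + R\<close> for the mean
  \<open>m\<close> of \<open>F\<close>, in integrated form. Under uniformization it becomes the
  recursion \<open>m \<le> (1 - 2 / c) * m + R / c\<close>, whose fixed point is
  \<open>R / 2\<close>.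
\<close>

lemma flow_drift:
  assumes drift: "\<And>y. y \<in> \<Omega> \<Longrightarrow> gen F y \<le> - 2 * F y + R"
    and R: "0 \<le> R" and x: "x \<in> \<Omega>" and t: "0 \<le> t"
  shows "flow t F x \<le> exp (- 2 * t) * F x + R / 2"
proof -
  obtain c0 where c0: "uniformizing c0" using uniformizing_exists by blast
  \<comment> \<open>At rate at least 2 the factor \<open>1 - 2 / c\<close> is nonnegative, so inequalities survive its powers.\<close>
  define c where "c = max c0 2"
  have c: "uniformizing c" and c2: "c \<ge> 2" using c0 unfolding uniformizing_def c_def by auto
  then have cpos: "c > 0" by simp
  define l where "l = 1 - 2 / c"
  have l: "0 \<le> l" using c2 by (simp add: l_def)
  have step: "(unif c ^^ m) F y \<le> l ^ m * (F y - R / 2) + R / 2" if "y \<in> \<Omega>" for m y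
    using that
  proof (induction m arbitrary: y)
    case (Suc m)
    have "(unif c ^^ Suc m) F y \<le> unif c (\<lambda>y. l ^ m * (F y - R / 2) + R / 2) y"
      using Suc by (auto intro!: unif_mono c)
    also have "\<dots> = l ^ m * (F y - R / 2) + R / 2 + l ^ m * gen F y / c"
      using Suc.prems by (simp add: unif_def gen_eq sum_distrib_left algebra_simps)
    also have "\<dots> \<le> l ^ m * (F y - R / 2) + R / 2 + l ^ m * (- 2 * F y + R) / c"
      using drift[OF Suc.prems] l cpos by (intro add_left_mono divide_right_mono mult_left_mono) auto
    also have "\<dots> = l ^ Suc m * (F y - R / 2) + R / 2"
      by (simp add: l_def algebra_simps add_divide_distrib diff_divide_distrib)
    finally show ?case .
  qed simp
  let ?w = "\<lambda>m. exp (- (c * t)) * (c * t) ^ m / fact m"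
  have bound_sums: "(\<lambda>m. ((c * t * l) ^ m /\<^sub>R fact m * (F x - R / 2) + (c * t) ^ m /\<^sub>R fact m * (R / 2)) * exp (- (c * t)))
    sums ((exp (c * t * l) * (F x - R / 2) + exp (c * t) * (R / 2)) * exp (- (c * t)))"
    by (intro sums_mult2 sums_add exp_converges)
  have limit: "(exp (c * t * l) * (F x - R / 2) + exp (c * t) * (R / 2)) * exp (- (c * t))
     = exp (- 2 * t) * (F x - R / 2) + R / 2"
  proof -
    have "exp (c * t * l) * exp (- (c * t)) = exp (- 2 * t)" "exp (c * t) * exp (- (c * t)) = 1"
      using cpos by (simp_all add: l_def algebra_simps flip: exp_add)
    then have "exp (c * t * l) * (F x - R / 2) * exp (- (c * t)) = exp (- 2 * t) * (F x - R / 2)"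
      "exp (c * t) * (R / 2) * exp (- (c * t)) = R / 2"
      by (metis mult.assoc mult.commute, metis mult.assoc mult.commute mult.left_neutral)
    then show ?thesis by (simp only: distrib_right)
  qed
  have bound: "?w m * (unif c ^^ m) F x \<le>
     ((c * t * l) ^ m /\<^sub>R fact m * (F x - R / 2) + (c * t) ^ m /\<^sub>R fact m * (R / 2)) * exp (- (c * t))" for m
  proof -
    have "?w m * (unif c ^^ m) F x \<le> ?w m * (l ^ m * (F x - R / 2) + R / 2)"
      using step[OF x] cpos t by (intro mult_left_mono) auto
    also have "\<dots> = ((c * t * l) ^ m /\<^sub>R fact m * (F x - R / 2) + (c * t) ^ m /\<^sub>R fact m * (R / 2)) * exp (- (c * t))"
    proof -
      have "E * W / f * (L * D + H) = ((W * L) /\<^sub>R f * D + W /\<^sub>R f * H) * E" for E W f L D H :: real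
        by (simp add: divide_inverse algebra_simps)
      then show ?thesis by (simp only: power_mult_distrib[of "c * t" l])
    qed
    finally show ?thesis .
  qed
  have "flow t F x \<le> exp (- 2 * t) * (F x - R / 2) + R / 2"
    using sums_le[OF bound uniformization[OF cpos x] bound_sums] unfolding limit .
  also have "\<dots> \<le> exp (- 2 * t) * F x + R / 2"
    using R by (simp add: algebra_simps)
  finally show ?thesis .
qed

subsection \<open>Rows of the transition matrix and stationary distributions\<close>

abbreviation point :: "'s \<Rightarrow> 's \<Rightarrow> real" where
  "point y \<equiv> (\<lambda>z. of_bool (z = y))"

lemma sum_unif_pow_point:
  assumes "x \<in> \<Omega>"
  shows "(\<Sum>y\<in>\<Omega>. F y * (unif c ^^ m) (point y) x) = (unif c ^^ m) F x"
proof -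
  have "(unif c ^^ m) F x = (unif c ^^ m) (\<lambda>z. \<Sum>y\<in>\<Omega>. F y * of_bool (z = y)) x"
    using assms by (intro unif_pow_cong point_decomposition)
  then show ?thesis by (simp add: unif_pow_sum)
qed

lemma transition_nonneg: "x \<in> \<Omega> \<Longrightarrow> y \<in> \<Omega> \<Longrightarrow> 0 \<le> t \<Longrightarrow> 0 \<le> transition \<Omega> r t x y"
  by (simp add: transition_eq_flow flow_nonneg)

lemma sum_transition: "x \<in> \<Omega> \<Longrightarrow> (\<Sum>y\<in>\<Omega>. transition \<Omega> r t x y) = 1"
  using expectation_transition[of x t "\<lambda>_. 1"] by (simp add: flow_const)

text \<open>
  A geometric bound for the powers of the uniformized kernel becomes an exponential bound for the
  semigroup, since \<open>l ^ m\<close> averaged over a Poisson variable \<open>m\<close> of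
  mean \<open>c * t\<close> is \<open>exp (- c * (1 - l) * t)\<close>.
\<close>

lemma affinity_transition:
  assumes c: "uniformizing c" and x: "x \<in> \<Omega>" and x': "x' \<in> \<Omega>" and t: "0 \<le> t"
    and step: "\<And>m. 1 - B * l ^ m \<le>
      affinity \<Omega> (\<lambda>y. (unif c ^^ m) (point y) x) (\<lambda>y. (unif c ^^ m) (point y) x')"
  shows "1 - B * exp (- (c * (1 - l) * t)) \<le> affinity \<Omega> (transition \<Omega> r t x) (transition \<Omega> r t x')"
proof -
  have cpos: "c > 0" using c by (simp add: uniformizing_def)
  define w where "w m = exp (- (c * t)) * (c * t) ^ m / fact m" for m
  have w0: "0 \<le> w m" for m using cpos t by (simp add: w_def)
  define g where "g m z y = (unif c ^^ m) (point y) z" for m z y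
  have g0: "0 \<le> g m z y" if "z \<in> \<Omega>" for m z y
    unfolding g_def using that by (intro unif_pow_nonneg c) auto
  \<comment> \<open>The affinity is monotone, so partial sums bound the affinity of the two Poisson mixtures from below.\<close>
  have partial: "(\<Sum>m<M. w m * g m z y) \<le> transition \<Omega> r t z y" if "z \<in> \<Omega>" "y \<in> \<Omega>" for M z y
  proof -
    have "(\<lambda>m. w m * g m z y) sums transition \<Omega> r t z y"
      using uniformization[OF cpos that(1), of t "point y"] that
      by (simp add: transition_eq_flow w_def g_def)
    then show ?thesis
      using w0 g0[OF that(1)] sum_le_suminf[of "\<lambda>m. w m * g m z y" "{..<M}"]
      by (auto simp: sums_iff)
  qed
  have "(\<Sum>m<M. w m * (1 - B * l ^ m)) \<le> affinity \<Omega> (transition \<Omega> r t x) (transition \<Omega> r t x')" for M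
  proof -
    have "(\<Sum>m<M. w m * (1 - B * l ^ m)) \<le> (\<Sum>m<M. w m * affinity \<Omega> (g m x) (g m x'))"
      using step w0 unfolding g_def by (intro sum_mono mult_left_mono) auto
    also have "\<dots> \<le> affinity \<Omega> (\<lambda>y. \<Sum>m<M. w m * g m x y) (\<lambda>y. \<Sum>m<M. w m * g m x' y)"
      using w0 g0 x x' by (intro affinity_superadditive) auto
    also have "\<dots> \<le> affinity \<Omega> (transition \<Omega> r t x) (transition \<Omega> r t x')"
      unfolding affinity_def using x x' w0 g0 partial
      by (intro sum_mono real_sqrt_le_mono mult_mono) (auto intro!: sum_nonneg transition_nonneg t)
    finally show ?thesis .
  qed
  moreover have "(\<lambda>m. w m * (1 - B * l ^ m)) sums (1 - B * exp (- (c * (1 - l) * t)))"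
  proof -
    have "(\<lambda>m. exp (- (c * t)) * ((c * t) ^ m /\<^sub>R fact m - B * ((c * t * l) ^ m /\<^sub>R fact m)))
       sums (exp (- (c * t)) * (exp (c * t) - B * exp (c * t * l)))"
      by (intro sums_mult sums_diff exp_converges)
    moreover have "exp (- (c * t)) * (exp (c * t) - B * exp (c * t * l)) = 1 - B * exp (- (c * (1 - l) * t))"
    proof -
      have "exp (- (c * t)) * exp (c * t * l) = exp (- (c * (1 - l) * t))" "exp (- (c * t)) * exp (c * t) = 1"
        by (simp_all add: algebra_simps flip: exp_add)
      then show ?thesis by (simp add: right_diff_distrib mult.left_commute)
    qed
    moreover have "exp (- (c * t)) * ((c * t) ^ m /\<^sub>R fact m - B * ((c * t * l) ^ m /\<^sub>R fact m))
        = w m * (1 - B * l ^ m)" for m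
    proof -
      have "E * (W /\<^sub>R f - B * ((W * L) /\<^sub>R f)) = E * W / f * (1 - B * L)" for E W f L :: real
        by (simp add: divide_inverse algebra_simps)
      then show ?thesis by (simp only: power_mult_distrib[of "c * t" l] w_def)
    qed
    ultimately show ?thesis by simp
  qed
  ultimately show ?thesis
    unfolding sums_def by (intro LIMSEQ_le_const2) auto
qed

text \<open>
  The stationary distribution is the mixture, with its own weights, of the laws at time
  \<open>t\<close>.
\<close>

lemma tv_stationary_le:
  assumes p: "stationary \<Omega> r p" and t: "0 \<le> t" and x: "x \<in> \<Omega>"
    and D: "\<And>x'. x' \<in> \<Omega> \<Longrightarrow> tv_dist \<Omega> (transition \<Omega> r t x) (transition \<Omega> r t x') \<le> D"
  shows "tv_dist \<Omega> (transition \<Omega> r t x) (pmf p) \<le> D"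
proof -
  have "(\<Sum>x\<in>\<Omega>. pmf p x) = 1"
    using p finite_states by (intro sum_pmf_eq_1) (auto simp: stationary_def)
  then have "tv_dist \<Omega> (transition \<Omega> r t x) (\<lambda>y. \<Sum>x'\<in>\<Omega>. pmf p x' * transition \<Omega> r t x' y) \<le> D"
    by (intro tv_dist_mixture_right D) auto
  also have "tv_dist \<Omega> (transition \<Omega> r t x) (\<lambda>y. \<Sum>x'\<in>\<Omega>. pmf p x' * transition \<Omega> r t x' y)
      = tv_dist \<Omega> (transition \<Omega> r t x) (pmf p)"
    unfolding tv_dist_def using p t by (simp add: stationary_def cong: sum.cong)
  finally show ?thesis .
qed

lemma stationary_unique:
  assumes "stationary \<Omega> r p" "stationary \<Omega> r p'"
    and D: "\<And>t x x'. 0 \<le> t \<Longrightarrow> x \<in> \<Omega> \<Longrightarrow> x' \<in> \<Omega> \<Longrightarrow>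
      tv_dist \<Omega> (transition \<Omega> r t x) (transition \<Omega> r t x') \<le> D t"
    and "(D \<longlongrightarrow> 0) at_top"
  shows "p = p'"
proof (rule pmf_eqI)
  fix y
  obtain x where x: "x \<in> \<Omega>" using assms(1) set_pmf_not_empty[of p] by (auto simp: stationary_def)
  have "tv_dist \<Omega> (pmf p) (pmf p') \<le> 2 * D t" if "0 \<le> t" for t
    using tv_dist_triangle[of \<Omega> "pmf p" "pmf p'" "transition \<Omega> r t x"]
      tv_stationary_le[OF assms(1) that x D[OF that x]] tv_stationary_le[OF assms(2) that x D[OF that x]]
    by (simp add: tv_dist_commute[of \<Omega> "pmf p"])
  moreover have "((\<lambda>t. 2 * D t) \<longlongrightarrow> 2 * 0) at_top"
    by (intro tendsto_intros assms)
  ultimately have "tv_dist \<Omega> (pmf p) (pmf p') \<le> 2 * 0"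
    by (intro tendsto_lowerbound[of "\<lambda>t. 2 * D t" "2 * 0" at_top])
      (auto intro: eventually_mono[OF eventually_ge_at_top[of 0]])
  then have "(\<Sum>y\<in>\<Omega>. \<bar>pmf p y - pmf p' y\<bar>) = 0"
    by (auto simp: tv_dist_def intro: antisym sum_nonneg)
  then have "pmf p y = pmf p' y" if "y \<in> \<Omega>"
    using that finite_states by (simp add: sum_nonneg_eq_0_iff)
  moreover have "pmf p y = pmf p' y" if "y \<notin> \<Omega>"
    using that assms(1,2) by (metis pmf_eq_0_set_pmf stationary_def subsetD)
  ultimately show "pmf p y = pmf p' y" by blast
qed

text \<open>
  Since a power of \<open>U\<close> averages the values of a function, the value
  \<open>(U ^ (k + M)) F x\<close> stays within the range of \<open>(U ^ M) F\<close>.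
  Small oscillation therefore makes the sequence of powers Cauchy at \<open>x\<close>; the limit,
  as a functional of \<open>F\<close>, is a probability vector that is fixed by \<open>U\<close>
  and hence annihilated by the generator.
\<close>

lemma stationary_exists:
  assumes c: "uniformizing c" and ne: "\<Omega> \<noteq> {}" and e: "e \<longlonglongrightarrow> 0"
    and osc: "\<And>m x x' y. x \<in> \<Omega> \<Longrightarrow> x' \<in> \<Omega> \<Longrightarrow> y \<in> \<Omega> \<Longrightarrow>
      \<bar>(unif c ^^ m) (point y) x - (unif c ^^ m) (point y) x'\<bar> \<le> e m"
  shows "\<exists>p. stationary \<Omega> r p"
proof -
  obtain x0 where x0: "x0 \<in> \<Omega>" using ne by blast
  have cpos: "c > 0" using c by (simp add: uniformizing_def)
  define a where "a y m = (unif c ^^ m) (point y) x0" for y m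
  have close: "\<bar>a y (k + M) - a y M\<bar> \<le> e M" if y: "y \<in> \<Omega>" for y k M
  proof -
    let ?G = "(unif c ^^ M) (point y)"
    have G: "a y M - e M \<le> ?G x" "?G x \<le> a y M + e M" if "x \<in> \<Omega>" for x
      using osc[OF that x0 y, of M] by (auto simp: a_def abs_le_iff)
    have "a y (k + M) = (unif c ^^ k) ?G x0" by (simp add: a_def funpow_add)
    moreover have "a y M - e M \<le> (unif c ^^ k) ?G x0"
      using unif_pow_mono[OF c G(1) x0, where m=k] by (simp add: unif_pow_const x0)
    moreover have "(unif c ^^ k) ?G x0 \<le> a y M + e M"
      using unif_pow_mono[OF c G(2) x0, where m=k] by (simp add: unif_pow_const x0)
    ultimately show ?thesis by (simp add: abs_le_iff)
  qed
  have conv: "convergent (a y)" if y: "y \<in> \<Omega>" for y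
  proof (rule Cauchy_convergent, rule CauchyI)
    fix \<epsilon> :: real assume "0 < \<epsilon>"
    then have "eventually (\<lambda>m. e m < \<epsilon> / 2) sequentially" using e by (intro order_tendstoD) auto
    then obtain M where M: "e M < \<epsilon> / 2" by (auto simp: eventually_sequentially)
    have "norm (a y m - a y n) < \<epsilon>" if "m \<ge> M" "n \<ge> M" for m n
      using close[OF y, of "m - M" M] close[OF y, of "n - M" M] that M by (simp add: abs_le_iff abs_less_iff)
    then show "\<exists>M. \<forall>m\<ge>M. \<forall>n\<ge>M. norm (a y m - a y n) < \<epsilon>" by blast
  qed
  \<comment> \<open>The value 0 outside the state space turns \<open>l\<close> into a mass function on the whole type.\<close>
  define l where "l y = (if y \<in> \<Omega> then lim (a y) else 0)" for y
  have lim: "a y \<longlonglongrightarrow> l y" if "y \<in> \<Omega>" for y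
    using conv[OF that] that by (simp add: l_def convergent_LIMSEQ_iff)
  have l0: "0 \<le> l y" for y
  proof (cases "y \<in> \<Omega>")
    case True
    have "0 \<le> a y m" for m unfolding a_def by (intro unif_pow_nonneg c x0) auto
    then show ?thesis using lim[OF True] by (intro LIMSEQ_le_const) auto
  qed (simp add: l_def)
  have limF: "(\<lambda>m. (unif c ^^ m) F x0) \<longlonglongrightarrow> (\<Sum>y\<in>\<Omega>. F y * l y)" for F
  proof -
    have "(\<lambda>m. \<Sum>y\<in>\<Omega>. F y * a y m) \<longlonglongrightarrow> (\<Sum>y\<in>\<Omega>. F y * l y)"
      by (intro tendsto_intros lim)
    then show ?thesis by (simp add: a_def sum_unif_pow_point x0)
  qed
  have l1: "sum l \<Omega> = 1"
  proof -
    have "(\<lambda>m. 1) \<longlonglongrightarrow> (\<Sum>y\<in>\<Omega>. l y)" using limF[of "\<lambda>_. 1"] by (simp add: unif_pow_const x0)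
    then show ?thesis by (simp add: LIMSEQ_const_iff)
  qed
  have "(\<Sum>y\<in>\<Omega>. unif c F y * l y) = (\<Sum>y\<in>\<Omega>. F y * l y)" for F
    using LIMSEQ_unique[OF limF[of "unif c F"]] LIMSEQ_Suc[OF limF[of F]]
    by (simp add: funpow_swap1)
  then have inv: "(\<Sum>y\<in>\<Omega>. l y * gen F y) = 0" for F
    using cpos by (simp add: unif_def distrib_right sum.distrib flip: sum_divide_distrib)
      (simp add: mult.commute)
  have flow: "(\<Sum>x\<in>\<Omega>. l x * flow t F x) = (\<Sum>x\<in>\<Omega>. l x * F x)" for t F
  proof -
    have "(\<lambda>k. \<Sum>x\<in>\<Omega>. l x * (t ^ k / fact k * (gen ^^ k) F x)) sums (\<Sum>x\<in>\<Omega>. l x * flow t F x)"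
      by (intro sums_sum sums_mult flow_sums)
    moreover have "(\<Sum>x\<in>\<Omega>. l x * (t ^ k / fact k * (gen ^^ k) F x)) = (if k = 0 then \<Sum>x\<in>\<Omega>. l x * F x else 0)" for k
    proof (cases k)
      case (Suc j)
      have "(\<Sum>x\<in>\<Omega>. l x * (t ^ k / fact k * (gen ^^ k) F x)) = t ^ k / fact k * (\<Sum>x\<in>\<Omega>. l x * gen ((gen ^^ j) F) x)"
        by (simp add: Suc sum_distrib_left mult.left_commute del: fact_Suc power_Suc)
      then show ?thesis using Suc by (simp add: inv)
    qed simp
    ultimately have "(\<lambda>k. if k = 0 then \<Sum>x\<in>\<Omega>. l x * F x else 0) sums (\<Sum>x\<in>\<Omega>. l x * flow t F x)"
      by simp
    moreover have "(\<lambda>k. if k = 0 then \<Sum>x\<in>\<Omega>. l x * F x else 0) sums (\<Sum>x\<in>\<Omega>. l x * F x)"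
      using sums_single[of 0 "\<lambda>_. \<Sum>x\<in>\<Omega>. l x * F x"] by simp
    ultimately show ?thesis by (rule sums_unique2)
  qed
  define p where "p = embed_pmf l"
  have pmf_p: "pmf p y = l y" for y
    unfolding p_def
  proof (rule pmf_embed_pmf)
    have "(\<integral>\<^sup>+ x. ennreal (l x) \<partial>count_space UNIV) = (\<integral>\<^sup>+ x. ennreal (l x) * indicator \<Omega> x \<partial>count_space UNIV)"
      by (intro nn_integral_cong) (auto simp: l_def indicator_def)
    also have "\<dots> = (\<integral>\<^sup>+ x. ennreal (l x) \<partial>count_space \<Omega>)"
      by (simp add: nn_integral_count_space_indicator)
    also have "\<dots> = (\<Sum>x\<in>\<Omega>. ennreal (l x))"
      by (rule nn_integral_count_space_finite[OF finite_states])
    also have "\<dots> = 1" using l0 l1 by (simp add: sum_ennreal)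
    finally show "(\<integral>\<^sup>+ x. ennreal (l x) \<partial>count_space UNIV) = 1" .
  qed (rule l0)
  have "stationary \<Omega> r p"
    unfolding stationary_def
  proof (intro conjI allI impI ballI subsetI)
    fix x assume "x \<in> set_pmf p"
    then show "x \<in> \<Omega>" by (auto simp: set_pmf_iff pmf_p l_def split: if_splits)
  next
    fix t y assume "y \<in> \<Omega>"
    then have "(\<Sum>x\<in>\<Omega>. pmf p x * transition \<Omega> r t x y) = (\<Sum>x\<in>\<Omega>. l x * flow t (point y) x)"
      by (intro sum.cong) (auto simp: pmf_p transition_eq_flow)
    also have "\<dots> = l y" using \<open>y \<in> \<Omega>\<close> finite_states by (simp add: flow sum.remove[of \<Omega> y])
    finally show "(\<Sum>x\<in>\<Omega>. pmf p x * transition \<Omega> r t x y) = pmf p y" by (simp add: pmf_p)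
  qed
  then show ?thesis by blast
qed

lemma stationary_expectation:
  assumes "stationary \<Omega> r p" "0 \<le> t"
  shows "(\<Sum>x\<in>\<Omega>. pmf p x * flow t F x) = (\<Sum>x\<in>\<Omega>. pmf p x * F x)"
proof -
  have "(\<Sum>x\<in>\<Omega>. pmf p x * flow t F x) = (\<Sum>x\<in>\<Omega>. \<Sum>y\<in>\<Omega>. pmf p x * transition \<Omega> r t x y * F y)"
    by (intro sum.cong refl) (simp add: expectation_transition[symmetric] sum_distrib_left mult.assoc)
  also have "\<dots> = (\<Sum>y\<in>\<Omega>. (\<Sum>x\<in>\<Omega>. pmf p x * transition \<Omega> r t x y) * F y)"
    by (subst sum.swap) (simp add: sum_distrib_right)
  also have "\<dots> = (\<Sum>y\<in>\<Omega>. pmf p y * F y)"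
    using assms by (simp add: stationary_def cong: sum.cong)
  finally show ?thesis .
qed

text \<open>
  The expectation of the semigroup at time \<open>t\<close> is a power series in \<open>t\<close>
  that is constant for \<open>t \<ge> 0\<close>, so its linear coefficient vanishes.
\<close>

lemma stationary_gen:
  assumes "stationary \<Omega> r p"
  shows "(\<Sum>x\<in>\<Omega>. pmf p x * gen F x) = 0"
proof -
  define g where "g k = (\<Sum>x\<in>\<Omega>. pmf p x * (gen ^^ k) F x) / fact k" for k
  have S: "(\<lambda>k. g k * t ^ k) sums (\<Sum>x\<in>\<Omega>. pmf p x * flow t F x)" for t
  proof -
    have "(\<lambda>k. \<Sum>x\<in>\<Omega>. pmf p x * (t ^ k / fact k * (gen ^^ k) F x)) sums (\<Sum>x\<in>\<Omega>. pmf p x * flow t F x)"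
      by (intro sums_sum sums_mult flow_sums)
    then show ?thesis by (simp add: g_def sum_divide_distrib sum_distrib_left ac_simps)
  qed
  \<comment> \<open>\<open>h\<close> is the series without its constant term, divided by \<open>t\<close>; it vanishes for \<open>t > 0\<close> and is continuous at 0.\<close>
  define h where "h t = (\<Sum>k. g (Suc k) * t ^ k)" for t
  have h_sums: "(\<lambda>k. g (Suc k) * t ^ k) sums h t" for t
  proof -
    have "summable (\<lambda>k. g k * t ^ k)" using S sums_summable by blast
    then have "summable (\<lambda>k. g (Suc k) * t ^ k)"
      by (subst (asm) summable_powser_split_head[symmetric])
    then show ?thesis unfolding h_def by (rule summable_sums)
  qed
  have h0: "h t = 0" if "t > 0" for t
  proof -
    have "(\<lambda>k. g k * t ^ k) sums g 0"
      using S[of t] stationary_expectation[OF assms less_imp_le[OF that], of F] by (simp add: g_def)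
    then have "(\<lambda>k. g (Suc k) * t ^ Suc k) sums 0"
      by (subst sums_Suc_iff) simp
    then have "(\<lambda>k. t * (g (Suc k) * t ^ k)) sums 0" by (simp add: mult.left_commute)
    moreover have "(\<lambda>k. t * (g (Suc k) * t ^ k)) sums (t * h t)" by (intro sums_mult h_sums)
    ultimately have "t * h t = 0" using sums_unique2 by blast
    then show ?thesis using that by simp
  qed
  have "(h \<longlongrightarrow> g (Suc 0)) (at 0)"
    by (rule powser_limit_0[where s=1 and a="\<lambda>k. g (Suc k)"]) (auto intro: h_sums)
  then have "(h \<longlongrightarrow> g (Suc 0)) (at_right 0)" by (rule tendsto_within_subset) auto
  moreover have "(h \<longlongrightarrow> 0) (at_right 0)"
    using h0 by (intro tendsto_eventually) (auto simp: eventually_at_right_less eventually_at_filter)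
  ultimately have "g (Suc 0) = 0" using tendsto_unique trivial_limit_at_right_real by blast
  then show ?thesis by (simp add: g_def)
qed

end

section \<open>Kernels that factorize over blocks of sites\<close>

lemma sum_PiE_union:
  fixes g :: "('a \<Rightarrow> 'b) \<Rightarrow> ('a \<Rightarrow> 'b) \<Rightarrow> real"
  assumes "A \<inter> B = {}"
  shows "(\<Sum>s\<in>(A \<union> B) \<rightarrow>\<^sub>E T. g (restrict s A) (restrict s B))
    = (\<Sum>s\<in>A \<rightarrow>\<^sub>E T. \<Sum>s'\<in>B \<rightarrow>\<^sub>E T. g s s')"
  unfolding sum.cartesian_product
proof (rule sum.reindex_bij_witness[where i="\<lambda>(s, s') x. if x \<in> A then s x else s' x"
      and j="\<lambda>s. (restrict s A, restrict s B)"], goal_cases)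
  case (1 s)
  then show ?case by (auto simp: fun_eq_iff PiE_def extensional_def)
next
  case (2 s)
  then show ?case by (auto simp: PiE_def)
next
  case (3 b)
  then show ?case using assms by (auto simp: fun_eq_iff PiE_def extensional_def)
next
  case (4 b)
  then show ?case using assms by (auto simp: PiE_def extensional_def)
next
  case (5 s)
  then show ?case by simp
qed

text \<open>
  Fubini for configurations: independent choices on disjoint blocks make up one choice on the
  union.
\<close>

lemma sum_prod_blocks:
  fixes g :: "'i \<Rightarrow> ('a \<Rightarrow> 'b) \<Rightarrow> real"
  assumes "finite Z" "disjoint_family_on B Z"
  shows "(\<Sum>s\<in>(\<Union>z\<in>Z. B z) \<rightarrow>\<^sub>E T. \<Prod>z\<in>Z. g z (restrict s (B z)))
    = (\<Prod>z\<in>Z. \<Sum>s\<in>B z \<rightarrow>\<^sub>E T. g z s)"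
  using assms
proof (induction Z rule: finite_induct)
  case empty
  then show ?case by simp
next
  case (insert z Z)
  let ?U = "\<Union>z\<in>Z. B z"
  have disj: "B z \<inter> ?U = {}" "disjoint_family_on B Z"
    using insert.prems insert.hyps by (auto simp: disjoint_family_on_def)
  have "(\<Sum>s\<in>(\<Union>z\<in>insert z Z. B z) \<rightarrow>\<^sub>E T. \<Prod>z\<in>insert z Z. g z (restrict s (B z)))
     = (\<Sum>s\<in>(B z \<union> ?U) \<rightarrow>\<^sub>E T. g z (restrict s (B z)) * (\<Prod>z\<in>Z. g z (restrict (restrict s ?U) (B z))))"
    using insert.hyps by (intro sum.cong) (auto simp: Int_absorb1 UN_upper intro!: prod.cong)
  also have "\<dots> = (\<Sum>s\<in>B z \<rightarrow>\<^sub>E T. \<Sum>s'\<in>?U \<rightarrow>\<^sub>E T. g z s * (\<Prod>z\<in>Z. g z (restrict s' (B z))))"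
    by (rule sum_PiE_union[OF disj(1)])
  also have "\<dots> = (\<Sum>s\<in>B z \<rightarrow>\<^sub>E T. g z s) * (\<Prod>z\<in>Z. \<Sum>s\<in>B z \<rightarrow>\<^sub>E T. g z s)"
    by (simp add: insert.IH[OF disj(2)] sum_product flip: sum_distrib_left sum_distrib_right)
  finally show ?case unfolding prod.insert[OF insert.hyps] .
qed

lemma sqrt_prod: "sqrt (\<Prod>i\<in>I. f i) = (\<Prod>i\<in>I. sqrt (f i))"
  by (induction I rule: infinite_finite_induct) (auto simp: real_sqrt_mult)

lemma prod_ge_one_minus_sum:
  fixes f c :: "'i \<Rightarrow> real"
  assumes "finite I" "\<And>i. i \<in> I \<Longrightarrow> 0 \<le> f i \<and> f i \<le> 1 \<and> 1 - f i \<le> c i"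
  shows "1 - (\<Sum>i\<in>I. c i) \<le> (\<Prod>i\<in>I. f i)"
  using assms
proof (induction I rule: finite_induct)
  case (insert i I)
  let ?P = "\<Prod>i\<in>I. f i"
  have P: "1 - (\<Sum>i\<in>I. c i) \<le> ?P" "0 \<le> ?P" "?P \<le> 1"
    using insert by (auto intro: prod_nonneg prod_le_1)
  have "(1 - f i) * ?P \<le> (1 - f i) * 1"
    using P insert.prems[of i] by (intro mult_left_mono) auto
  moreover have "1 - f i \<le> c i" using insert.prems by simp
  ultimately show ?case using P insert.hyps by (simp add: algebra_simps)
qed simp

definition block :: "'a set \<Rightarrow> ('a \<Rightarrow> 'a) \<Rightarrow> 'a \<Rightarrow> 'a set" where
  "block S a z = {x \<in> S. a x = z}"

definition stochastic :: "'s set \<Rightarrow> ('s \<Rightarrow> real) \<Rightarrow> bool" where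
  "stochastic \<Omega> p \<longleftrightarrow> (\<forall>s\<in>\<Omega>. 0 \<le> p s) \<and> sum p \<Omega> = 1"

text \<open>
  The kernel \<open>K\<close> sends a configuration \<open>\<eta>\<close> to a random one whose
  restrictions to the blocks of \<open>a\<close> are independent, the block of \<open>z\<close>
  being produced from the single bit \<open>\<eta> z\<close>. Thus \<open>a x\<close> is the
  ancestor of \<open>x\<close>, and \<open>c z\<close> bounds how well the block of
  \<open>z\<close> reveals the bit at \<open>z\<close>. Blocks may be empty; the corresponding
  factor is then 1.
\<close>

definition block_product ::
  "'a set \<Rightarrow> ('a \<Rightarrow> 'a) \<Rightarrow> ('a \<Rightarrow> nat \<Rightarrow> ('a \<Rightarrow> nat) \<Rightarrow> real) \<Rightarrow> ('a \<Rightarrow> real) \<Rightarrow>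
    (('a \<Rightarrow> nat) \<Rightarrow> ('a \<Rightarrow> nat) \<Rightarrow> real) \<Rightarrow> bool" where
  "block_product S a k c K \<longleftrightarrow> a \<in> S \<rightarrow> S \<and>
     (\<forall>z\<in>S. \<forall>u\<in>{0, 1}. stochastic (configs (block S a z)) (k z u)) \<and>
     (\<forall>z\<in>S. 1 - affinity (configs (block S a z)) (k z 0) (k z 1) \<le> c z) \<and>
     (\<forall>\<eta>\<in>configs S. \<forall>\<xi>\<in>configs S. K \<eta> \<xi> = (\<Prod>z\<in>S. k z (\<eta> z) (restrict \<xi> (block S a z))))"

definition blockwise ::
  "'a set \<Rightarrow> ('a \<Rightarrow> real) \<Rightarrow> (('a \<Rightarrow> nat) \<Rightarrow> ('a \<Rightarrow> nat) \<Rightarrow> real) \<Rightarrow> bool" where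
  "blockwise S c K \<longleftrightarrow> (\<exists>a k. block_product S a k c K)"

lemma block_productD:
  assumes "block_product S a k c K"
  shows "a \<in> S \<rightarrow> S"
    and "z \<in> S \<Longrightarrow> u \<in> {0, 1} \<Longrightarrow> stochastic (configs (block S a z)) (k z u)"
    and "z \<in> S \<Longrightarrow> 1 - affinity (configs (block S a z)) (k z 0) (k z 1) \<le> c z"
    and "\<eta> \<in> configs S \<Longrightarrow> \<xi> \<in> configs S \<Longrightarrow>
      K \<eta> \<xi> = (\<Prod>z\<in>S. k z (\<eta> z) (restrict \<xi> (block S a z)))"
  using assms unfolding block_product_def by blast+

lemma configs_val: "\<eta> \<in> configs S \<Longrightarrow> x \<in> S \<Longrightarrow> \<eta> x \<in> {0, 1}"
  unfolding configs_def by (rule PiE_mem)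

lemma configs_update:
  assumes "\<eta> \<in> configs S" "x \<in> S" "b \<in> {0, 1}"
  shows "\<eta>(x := b) \<in> configs S"
  using PiE_fun_upd[of b "\<lambda>_. {0, 1}" x \<eta> S] assms by (simp add: configs_def insert_absorb)

lemma restrict_configs: "\<xi> \<in> configs S \<Longrightarrow> B \<subseteq> S \<Longrightarrow> restrict \<xi> B \<in> configs B"
  unfolding configs_def by (auto dest: PiE_mem)

lemma stochastic_prod_blocks:
  assumes "finite Z" "disjoint_family_on B Z" "\<And>z. z \<in> Z \<Longrightarrow> stochastic (configs (B z)) (p z)"
  shows "stochastic (configs (\<Union>z\<in>Z. B z)) (\<lambda>s. \<Prod>z\<in>Z. p z (restrict s (B z)))"
proof -
  have "0 \<le> (\<Prod>z\<in>Z. p z (restrict s (B z)))" if "s \<in> configs (\<Union>z\<in>Z. B z)" for s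
    using assms(3) restrict_configs[OF that] by (intro prod_nonneg) (auto simp: stochastic_def UN_upper)
  moreover have "(\<Sum>s\<in>configs (\<Union>z\<in>Z. B z). \<Prod>z\<in>Z. p z (restrict s (B z))) = 1"
    using assms unfolding configs_def by (subst sum_prod_blocks) (auto simp: stochastic_def intro!: prod.neutral)
  ultimately show ?thesis by (simp add: stochastic_def)
qed

text \<open>
  Affinity is multiplicative over independent blocks, and
  \<open>1 - (\<Prod>i. b i) \<le> (\<Sum>i. 1 - b i)\<close>.
\<close>

lemma affinity_prod_blocks:
  assumes "finite Z" "disjoint_family_on B Z"
    and "\<And>z. z \<in> Z \<Longrightarrow> stochastic (configs (B z)) (p z)" "\<And>z. z \<in> Z \<Longrightarrow> stochastic (configs (B z)) (q z)"
    and "\<And>z. z \<in> Z \<Longrightarrow> 1 - affinity (configs (B z)) (p z) (q z) \<le> c z"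
  shows "1 - affinity (configs (\<Union>z\<in>Z. B z)) (\<lambda>s. \<Prod>z\<in>Z. p z (restrict s (B z)))
    (\<lambda>s. \<Prod>z\<in>Z. q z (restrict s (B z))) \<le> (\<Sum>z\<in>Z. c z)"
proof -
  have "affinity (configs (\<Union>z\<in>Z. B z)) (\<lambda>s. \<Prod>z\<in>Z. p z (restrict s (B z)))
      (\<lambda>s. \<Prod>z\<in>Z. q z (restrict s (B z)))
    = (\<Sum>s\<in>configs (\<Union>z\<in>Z. B z). \<Prod>z\<in>Z. sqrt (p z (restrict s (B z)) * q z (restrict s (B z))))"
    by (simp add: affinity_def sqrt_prod flip: prod.distrib)
  also have "\<dots> = (\<Prod>z\<in>Z. affinity (configs (B z)) (p z) (q z))"
    unfolding configs_def affinity_def using assms(1,2)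
    by (rule sum_prod_blocks[where g="\<lambda>z s. sqrt (p z s * q z s)"])
  finally show ?thesis
    using prod_ge_one_minus_sum[of Z "\<lambda>z. affinity (configs (B z)) (p z) (q z)" c] assms
    by (simp add: stochastic_def affinity_nonneg affinity_le_1)
qed

lemma UN_block: "a \<in> S \<rightarrow> S \<Longrightarrow> (\<Union>z\<in>S. block S a z) = S"
  by (auto simp: block_def)

lemma disjoint_block: "disjoint_family_on (block S a) Z"
  by (auto simp: disjoint_family_on_def block_def)

lemma blockwise_identity:
  assumes "finite S"
  shows "blockwise S (\<lambda>_. 1) (\<lambda>\<eta> \<xi>. of_bool (\<eta> = \<xi>))"
  unfolding blockwise_def block_product_def
proof (intro exI conjI ballI)
  let ?k = "\<lambda>(z :: 'a) (u :: nat) s. of_bool (s z = u) :: real"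
  show "(\<lambda>x. x) \<in> S \<rightarrow> S" by simp
  fix z assume z: "z \<in> S"
  then have b: "block S (\<lambda>x. x) z = {z}" by (auto simp: block_def)
  have conf: "configs {z} = (\<lambda>b. \<lambda>x\<in>{z}. b) ` {0, 1}"
    unfolding configs_def PiE_over_singleton_iff by auto
  have inj: "inj_on (\<lambda>b. \<lambda>x\<in>{z}. b) {0 :: nat, 1}"
    by (rule inj_onI) (metis restrict_apply' singletonI)
  show "stochastic (configs (block S (\<lambda>x. x) z)) (?k z u)" if "u \<in> {0, 1}" for u
    using that unfolding b stochastic_def conf sum.reindex[OF inj] by auto
  show "1 - affinity (configs (block S (\<lambda>x. x) z)) (?k z 0) (?k z 1) \<le> 1"
    by (simp add: affinity_nonneg)
next
  fix \<eta> \<xi> assume "\<eta> \<in> configs S" "\<xi> \<in> configs S"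
  then have "\<eta> = \<xi> \<longleftrightarrow> (\<forall>z\<in>S. \<xi> z = \<eta> z)"
    unfolding configs_def by (metis PiE_ext)
  moreover have "(\<Prod>z\<in>S. of_bool (restrict \<xi> (block S (\<lambda>x. x) z) z = \<eta> z))
    = (of_bool (\<forall>z\<in>S. \<xi> z = \<eta> z) :: real)"
    using assms by (auto simp: block_def prod_zero_iff intro!: prod.neutral)
  ultimately show "of_bool (\<eta> = \<xi>) = (\<Prod>z\<in>S. of_bool (restrict \<xi> (block S (\<lambda>x. x) z) z = \<eta> z) :: real)"
    by simp
qed

text \<open>
  A voting move before \<open>K\<close> is the case where \<open>f\<close> sends one site to
  another and fixes the rest. Sites with the same image share their ancestor from now on, so
  their blocks merge and their costs add up.
\<close>

lemma blockwise_relabel: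
  assumes fin: "finite S" and f: "f \<in> S \<rightarrow> S" and K: "blockwise S c K"
  shows "blockwise S (\<lambda>w. \<Sum>z\<in>{z \<in> S. f z = w}. c z) (\<lambda>\<eta>. K (\<lambda>x\<in>S. \<eta> (f x)))"
proof -
  obtain a k where ak: "block_product S a k c K" using K unfolding blockwise_def by (elim exE)
  note a = block_productD(1)[OF ak] and k = block_productD(2)[OF ak]
    and c = block_productD(3)[OF ak] and K' = block_productD(4)[OF ak]
  define F where "F w = {z \<in> S. f z = w}" for w
  have finF: "finite (F w)" for w using fin by (simp add: F_def)
  define k' where "k' w u s = (\<Prod>z\<in>F w. k z u (restrict s (block S a z)))" for w u s
  have blk: "block S (\<lambda>x. f (a x)) w = (\<Union>z\<in>F w. block S a z)" for w
    using a by (auto simp: block_def F_def)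
  have K'': "K (\<lambda>x\<in>S. \<eta> (f x)) \<xi>
     = (\<Prod>w\<in>S. k' w (\<eta> w) (restrict \<xi> (block S (\<lambda>x. f (a x)) w)))"
    if "\<eta> \<in> configs S" "\<xi> \<in> configs S" for \<eta> \<xi>
  proof -
    have "(\<lambda>x\<in>S. \<eta> (f x)) \<in> configs S"
      using that(1) f unfolding configs_def by (intro restrict_PiE_iff[THEN iffD2] ballI) (auto dest: PiE_mem)
    then have "K (\<lambda>x\<in>S. \<eta> (f x)) \<xi> = (\<Prod>z\<in>S. k z (\<eta> (f z)) (restrict \<xi> (block S a z)))"
      using that(2) by (simp add: K' cong: prod.cong)
    also have "\<dots> = (\<Prod>w\<in>S. \<Prod>z\<in>F w. k z (\<eta> (f z)) (restrict \<xi> (block S a z)))"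
      unfolding F_def using fin f by (intro prod.group[symmetric]) auto
    also have "\<dots> = (\<Prod>w\<in>S. k' w (\<eta> w) (restrict \<xi> (block S (\<lambda>x. f (a x)) w)))"
      unfolding k'_def blk
      by (intro prod.cong refl) (auto simp: F_def Int_absorb1 UN_upper)
    finally show ?thesis .
  qed
  have "stochastic (configs (block S (\<lambda>x. f (a x)) w)) (k' w u)" if "u \<in> {0, 1}" for w u
    unfolding blk k'_def using that finF k by (intro stochastic_prod_blocks disjoint_block) (auto simp: F_def)
  moreover have "1 - affinity (configs (block S (\<lambda>x. f (a x)) w)) (k' w 0) (k' w 1) \<le> (\<Sum>z\<in>F w. c z)" for w
    unfolding blk k'_def using finF k c by (intro affinity_prod_blocks disjoint_block) (auto simp: F_def)
  moreover have "(\<lambda>x. f (a x)) \<in> S \<rightarrow> S" using a f by auto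
  ultimately show ?thesis
    unfolding blockwise_def block_product_def F_def[symmetric]
    by (intro exI[of _ "\<lambda>x. f (a x)"] exI[of _ k'] conjI ballI K'')
qed

text \<open>
  Rerandomizing the bit at \<open>x\<close> with probability \<open>d\<close> before
  \<open>K\<close> only changes the law of the block of \<open>x\<close>, and
  \<open>affinity_noise\<close> measures by how much.
\<close>

lemma blockwise_noise:
  assumes fin: "finite S" and x: "x \<in> S" and d: "0 \<le> d" "d \<le> 1" and K: "blockwise S c K"
  shows "blockwise S (c(x := (1 - d)\<^sup>2 * c x))
    (\<lambda>\<eta> \<xi>. (1 - d) * K \<eta> \<xi> + d / 2 * (K (\<eta>(x := 0)) \<xi> + K (\<eta>(x := 1)) \<xi>))"
proof -
  obtain a k where ak: "block_product S a k c K" using K unfolding blockwise_def by (elim exE)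
  note a = block_productD(1)[OF ak] and k = block_productD(2)[OF ak]
    and c = block_productD(3)[OF ak] and K' = block_productD(4)[OF ak]
  let ?C = "configs (block S a x)"
  define kx where "kx u s = (1 - d) * k x u s + d / 2 * (k x 0 s + k x 1 s)" for u s
  define k' where "k' = k(x := kx)"
  have st: "stochastic ?C (k x 0)" "stochastic ?C (k x 1)" using k x by auto
  have kx: "stochastic ?C (kx u)" if "u \<in> {0, 1}" for u
  proof -
    have "(\<Sum>s\<in>?C. kx u s) = (1 - d) * sum (k x u) ?C + d / 2 * (sum (k x 0) ?C + sum (k x 1) ?C)"
      unfolding kx_def sum.distrib sum_distrib_left[symmetric] ..
    then show ?thesis
      using st that d by (auto simp: stochastic_def kx_def)
  qed
  have "1 - affinity ?C (kx 0) (kx 1) \<le> (1 - d)\<^sup>2 * (1 - affinity ?C (k x 0) (k x 1))"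
    unfolding kx_def using st d by (intro affinity_noise) (auto simp: stochastic_def)
  also have "\<dots> \<le> (1 - d)\<^sup>2 * c x"
    using c[OF x] by (intro mult_left_mono) auto
  finally have cx: "1 - affinity ?C (kx 0) (kx 1) \<le> (1 - d)\<^sup>2 * c x" .
  have K'': "(1 - d) * K \<eta> \<xi> + d / 2 * (K (\<eta>(x := 0)) \<xi> + K (\<eta>(x := 1)) \<xi>)
     = (\<Prod>z\<in>S. k' z (\<eta> z) (restrict \<xi> (block S a z)))"
    if \<eta>: "\<eta> \<in> configs S" and \<xi>: "\<xi> \<in> configs S" for \<eta> \<xi>
  proof -
    have upd: "\<eta>(x := b) \<in> configs S" if "b \<in> {0, 1}" for b
      using configs_update[OF \<eta> x that] .
    define R where "R = (\<Prod>z\<in>S - {x}. k z (\<eta> z) (restrict \<xi> (block S a z)))"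
    let ?s = "restrict \<xi> (block S a x)"
    have rest: "(\<Prod>z\<in>S - {x}. k z ((\<eta>(x := b)) z) (restrict \<xi> (block S a z))) = R" for b
      unfolding R_def by (intro prod.cong) auto
    have "K \<eta> \<xi> = k x (\<eta> x) ?s * R"
      unfolding K'[OF \<eta> \<xi>] R_def by (rule prod.remove[OF fin x])
    moreover have "K (\<eta>(x := b)) \<xi> = k x b ?s * R" if "b \<in> {0, 1}" for b
      unfolding K'[OF upd[OF that] \<xi>] prod.remove[OF fin x] rest by simp
    moreover have "(\<Prod>z\<in>S. k' z (\<eta> z) (restrict \<xi> (block S a z))) = kx (\<eta> x) ?s * R"
      unfolding prod.remove[OF fin x] R_def by (simp add: k'_def)
    ultimately show ?thesis by (simp add: kx_def algebra_simps)
  qed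
  show ?thesis
    unfolding blockwise_def block_product_def
  proof (intro exI[of _ a] exI[of _ k'] conjI ballI a K'')
    fix z assume z: "z \<in> S"
    show "stochastic (configs (block S a z)) (k' z u)" if "u \<in> {0, 1}" for u
      using k[OF z that] kx[OF that] by (simp add: k'_def)
    show "1 - affinity (configs (block S a z)) (k' z 0) (k' z 1) \<le> (c(x := (1 - d)\<^sup>2 * c x)) z"
      using c[OF z] cx by (simp add: k'_def)
  qed
qed

lemma blockwise_cost_nonneg:
  assumes K: "blockwise S c K" and z: "z \<in> S"
  shows "0 \<le> c z"
proof -
  obtain a k where ak: "block_product S a k c K" using K unfolding blockwise_def by (elim exE)
  have "affinity (configs (block S a z)) (k z 0) (k z 1) \<le> 1"
    using block_productD(2)[OF ak z, of 0] block_productD(2)[OF ak z, of 1]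
    by (intro affinity_le_1) (auto simp: stochastic_def)
  then show ?thesis using block_productD(3)[OF ak z] by simp
qed

lemma blockwise_nonneg:
  assumes K: "blockwise S c K" and \<eta>: "\<eta> \<in> configs S" and \<xi>: "\<xi> \<in> configs S"
  shows "0 \<le> K \<eta> \<xi>"
proof -
  obtain a k where ak: "block_product S a k c K" using K unfolding blockwise_def by (elim exE)
  have "0 \<le> k z (\<eta> z) (restrict \<xi> (block S a z))" if "z \<in> S" for z
    using block_productD(2)[OF ak that configs_val[OF \<eta> that]] restrict_configs[OF \<xi>, of "block S a z"]
    by (auto simp: stochastic_def block_def)
  then show ?thesis unfolding block_productD(4)[OF ak \<eta> \<xi>] by (intro prod_nonneg) auto
qed

text \<open>
  Whatever the two initial configurations are, each block contributes either its cost or nothing.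
\<close>

lemma blockwise_affinity:
  assumes fin: "finite S" and K: "blockwise S c K" and \<eta>: "\<eta> \<in> configs S" and \<eta>': "\<eta>' \<in> configs S"
  shows "1 - (\<Sum>z\<in>S. c z) \<le> affinity (configs S) (K \<eta>) (K \<eta>')"
proof -
  obtain a k where ak: "block_product S a k c K" using K unfolding blockwise_def by (elim exE)
  note a = block_productD(1)[OF ak] and k = block_productD(2)[OF ak]
    and c = block_productD(3)[OF ak] and K' = block_productD(4)[OF ak]
  have "1 - affinity (configs (block S a z)) (k z u) (k z v) \<le> c z"
    if z: "z \<in> S" and uv: "u \<in> {0, 1}" "v \<in> {0, 1}" for z u v
  proof (cases "u = v")
    case True
    then show ?thesis using k[OF z uv(1)] blockwise_cost_nonneg[OF K z]
      by (simp add: affinity_refl stochastic_def)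
  next
    case False
    then show ?thesis using c[OF z] uv by (auto simp: affinity_commute)
  qed
  then have "1 - affinity (configs (\<Union>z\<in>S. block S a z)) (\<lambda>s. \<Prod>z\<in>S. k z (\<eta> z) (restrict s (block S a z)))
    (\<lambda>s. \<Prod>z\<in>S. k z (\<eta>' z) (restrict s (block S a z))) \<le> (\<Sum>z\<in>S. c z)"
    using k configs_val[OF \<eta>] configs_val[OF \<eta>']
    by (intro affinity_prod_blocks fin disjoint_block) auto
  moreover have "affinity (configs S) (\<lambda>s. \<Prod>z\<in>S. k z (\<eta> z) (restrict s (block S a z)))
    (\<lambda>s. \<Prod>z\<in>S. k z (\<eta>' z) (restrict s (block S a z))) = affinity (configs S) (K \<eta>) (K \<eta>')"
    unfolding affinity_def using K' \<eta> \<eta>' by (intro sum.cong) auto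
  ultimately show ?thesis by (simp add: UN_block[OF a])
qed

section \<open>Upper bound for the noisy voter model\<close>

locale voter =
  fixes S :: "'a set" and q :: "'a \<Rightarrow> 'a \<Rightarrow> real"
  assumes finite_sites: "finite S" and sites_nonempty: "S \<noteq> {}"
    and q_nonneg: "\<And>x y. x \<in> S \<Longrightarrow> y \<in> S \<Longrightarrow> x \<noteq> y \<Longrightarrow> 0 \<le> q x y"
begin

abbreviation "\<Omega> \<equiv> configs S"

lemma finite_configs: "finite \<Omega>"
  unfolding configs_def using finite_sites by (intro finite_PiE) auto

lemma configs_nonempty: "\<Omega> \<noteq> {}"
  unfolding configs_def by (simp add: PiE_eq_empty_iff)

sublocale rates \<Omega> "voter_rate S q"
proof
  show "0 \<le> voter_rate S q \<eta> \<xi>" for \<eta> \<xi>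
    unfolding voter_rate_def by (intro sum_nonneg add_nonneg_nonneg) (auto intro: q_nonneg)
qed (rule finite_configs)

lemma gen_voter:
  assumes \<eta>: "\<eta> \<in> \<Omega>"
  shows "gen F \<eta> = (\<Sum>x\<in>S. (\<Sum>y\<in>S - {x}. q x y * (F (\<eta>(x := \<eta> y)) - F \<eta>))
    + (\<Sum>b\<in>{0, 1}. 1 / 2 * (F (\<eta>(x := b)) - F \<eta>)))"
proof -
  define G where "G \<xi> = F \<xi> - F \<eta>" for \<xi>
  have pick: "(\<Sum>\<xi>\<in>\<Omega>. (if \<xi> = \<zeta> then v else 0) * G \<xi>) = v * G \<zeta>" if "\<zeta> \<in> \<Omega>" for \<zeta> and v :: real
  proof -
    have "(\<Sum>\<xi>\<in>\<Omega>. (if \<xi> = \<zeta> then v else 0) * G \<xi>) = (\<Sum>\<xi>\<in>\<Omega>. if \<xi> = \<zeta> then v * G \<zeta> else 0)"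
      by (intro sum.cong) auto
    then show ?thesis using that finite_configs by simp
  qed
  have "gen F \<eta> = (\<Sum>\<xi>\<in>\<Omega>. voter_rate S q \<eta> \<xi> * G \<xi>)"
    unfolding gen_eq[OF \<eta>] G_def using finite_configs \<eta> by (intro sum.mono_neutral_left) auto
  also have "\<dots> = (\<Sum>\<xi>\<in>\<Omega>. \<Sum>x\<in>S. (\<Sum>y\<in>S - {x}. (if \<xi> = \<eta>(x := \<eta> y) then q x y else 0) * G \<xi>)
     + (\<Sum>b\<in>{0, 1}. (if \<xi> = \<eta>(x := b) then 1 / 2 else 0) * G \<xi>))"
    unfolding voter_rate_def by (simp only: sum_distrib_right distrib_right)
  also have "\<dots> = (\<Sum>x\<in>S. (\<Sum>y\<in>S - {x}. \<Sum>\<xi>\<in>\<Omega>. (if \<xi> = \<eta>(x := \<eta> y) then q x y else 0) * G \<xi>)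
     + (\<Sum>b\<in>{0, 1}. \<Sum>\<xi>\<in>\<Omega>. (if \<xi> = \<eta>(x := b) then 1 / 2 else 0) * G \<xi>))"
    by (subst sum.swap, simp only: sum.distrib, subst (2 4) sum.swap, rule refl)
  also have "\<dots> = (\<Sum>x\<in>S. (\<Sum>y\<in>S - {x}. q x y * G (\<eta>(x := \<eta> y)))
     + (\<Sum>b\<in>{0, 1}. 1 / 2 * G (\<eta>(x := b))))"
    using configs_update[OF \<eta>] configs_val[OF \<eta>]
    by (intro sum.cong arg_cong2[where f="(+)"] refl pick) auto
  finally show ?thesis by (simp only: G_def)
qed

definition total_rate :: real where
  "total_rate = (\<Sum>x\<in>S. \<Sum>y\<in>S - {x}. q x y)"

lemma total_rate_nonneg: "0 \<le> total_rate"
  unfolding total_rate_def by (intro sum_nonneg q_nonneg) auto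

lemma card_pos: "0 < card S"
  using finite_sites sites_nonempty by (simp add: card_gt_0_iff)

text \<open>
  One step of the kernel uniformized at rate \<open>r\<close> is decomposed as follows. With
  probability \<open>total_rate / r\<close> a voting move is made. Otherwise a uniformly chosen
  site is rerandomized with probability \<open>noise r\<close>, which is the value that makes
  every site rerandomize at rate 1. Attaching the event of no change at all to a site in this way
  is what keeps each part of the mixture a kernel of product form with a reduced cost.
\<close>

definition noise :: "real \<Rightarrow> real" where
  "noise r = card S / (r - total_rate)"

text \<open>
  Pairs of distinct sites \<open>(x, y)\<close> index the voting move of \<open>x\<close>
  towards \<open>y\<close>, and the diagonal pair \<open>(x, x)\<close> indexes the
  rerandomization at \<open>x\<close>.
\<close>

definition weight :: "real \<Rightarrow> 'a \<times> 'a \<Rightarrow> real" where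
  "weight r = (\<lambda>(x, y). if x = y then (1 - total_rate / r) / card S else q x y / r)"

definition move ::
  "real \<Rightarrow> (('a \<Rightarrow> nat) \<Rightarrow> ('a \<Rightarrow> nat) \<Rightarrow> real) \<Rightarrow> 'a \<times> 'a \<Rightarrow> ('a \<Rightarrow> nat) \<Rightarrow> ('a \<Rightarrow> nat) \<Rightarrow> real" where
  "move r K = (\<lambda>(x, y). if x = y
     then (\<lambda>\<eta> \<xi>. (1 - noise r) * K \<eta> \<xi> + noise r / 2 * (K (\<eta>(x := 0)) \<xi> + K (\<eta>(x := 1)) \<xi>))
     else (\<lambda>\<eta>. K (\<lambda>z\<in>S. \<eta> (if z = x then y else z))))"

definition move_cost :: "real \<Rightarrow> ('a \<Rightarrow> real) \<Rightarrow> 'a \<times> 'a \<Rightarrow> 'a \<Rightarrow> real" where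
  "move_cost r c = (\<lambda>(x, y). if x = y then c(x := (1 - noise r)\<^sup>2 * c x)
     else (\<lambda>w. \<Sum>z\<in>{z \<in> S. (if z = x then y else z) = w}. c z))"

text \<open>
  For large \<open>r\<close> this is \<open>1 - 2 / r\<close> up to terms of order
  \<open>1 / r\<^sup>2\<close>, so costs decay at rate 2.
\<close>

definition contraction_factor :: "real \<Rightarrow> real" where
  "contraction_factor r = 1 - (2 - noise r) / r"

lemma sum_pairs:
  "(\<Sum>i\<in>S \<times> S. f i) = (\<Sum>x\<in>S. f (x, x) + (\<Sum>y\<in>S - {x}. f (x, y)))"
proof -
  have "(\<Sum>i\<in>S \<times> S. f i) = (\<Sum>x\<in>S. \<Sum>y\<in>S. f (x, y))" by (simp add: sum.cartesian_product)
  also have "\<dots> = (\<Sum>x\<in>S. f (x, x) + (\<Sum>y\<in>S - {x}. f (x, y)))"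
    using finite_sites by (intro sum.cong refl sum.remove) auto
  finally show ?thesis .
qed

context
  fixes r :: real
  assumes r: "total_rate + card S \<le> r"
begin

lemma r_pos: "0 < r" "0 < r - total_rate"
  using r card_pos total_rate_nonneg by linarith+

lemma noise_range: "0 \<le> noise r" "noise r \<le> 1"
  using r r_pos by (simp_all add: noise_def)

lemma weight_noise: "(1 - total_rate / r) * noise r = card S / r"
  using r_pos by (simp add: noise_def field_simps)

lemma weight_nonneg: "i \<in> S \<times> S \<Longrightarrow> 0 \<le> weight r i"
  using r_pos q_nonneg by (auto simp: weight_def)

lemma sum_weight_off: "(\<Sum>x\<in>S. \<Sum>y\<in>S - {x}. weight r (x, y) * a) = total_rate / r * a"
proof -
  have "(\<Sum>x\<in>S. \<Sum>y\<in>S - {x}. weight r (x, y) * a) = (\<Sum>x\<in>S. \<Sum>y\<in>S - {x}. q x y * (a / r))"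
    by (intro sum.cong refl) (auto simp: weight_def)
  also have "\<dots> = total_rate * (a / r)"
    by (simp only: total_rate_def sum_distrib_right)
  finally show ?thesis by simp
qed

lemma sum_weight_diag: "(\<Sum>x\<in>S. weight r (x, x) * g x) = (1 - total_rate / r) / card S * (\<Sum>x\<in>S. g x)"
  by (simp add: weight_def sum_distrib_left)

lemma sum_weight: "(\<Sum>i\<in>S \<times> S. weight r i) = 1"
  using sum_weight_diag[of "\<lambda>_. 1"] sum_weight_off[of 1] card_pos
  by (simp add: sum_pairs sum.distrib)

text \<open>
  Voting moves preserve the total cost. The rerandomization at \<open>x\<close> removes the share
  \<open>noise r * (2 - noise r)\<close> of the cost of \<open>x\<close>, and averaging
  over \<open>x\<close> removes the same share of the average cost.
\<close>

lemma sum_move_cost: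
  "(\<Sum>i\<in>S \<times> S. weight r i * (\<Sum>z\<in>S. move_cost r c i z)) = contraction_factor r * (\<Sum>z\<in>S. c z)"
proof -
  let ?C = "\<Sum>z\<in>S. c z" and ?d = "noise r"
  have diag: "(\<Sum>z\<in>S. move_cost r c (x, x) z) = ?C - ?d * (2 - ?d) * c x" if x: "x \<in> S" for x
  proof -
    have "(\<Sum>z\<in>S. move_cost r c (x, x) z) = (1 - ?d)\<^sup>2 * c x + (\<Sum>z\<in>S - {x}. c z)"
      using finite_sites x by (subst sum.remove[of S x]) (auto simp: move_cost_def)
    moreover have "?C = c x + (\<Sum>z\<in>S - {x}. c z)" using finite_sites x by (rule sum.remove)
    ultimately show ?thesis by (simp add: power2_eq_square algebra_simps)
  qed
  have off: "(\<Sum>z\<in>S. move_cost r c (x, y) z) = ?C" if "x \<in> S" "y \<in> S - {x}" for x y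
  proof -
    have "(\<Sum>z\<in>S. move_cost r c (x, y) z)
      = (\<Sum>w\<in>S. \<Sum>z\<in>{z \<in> S. (if z = x then y else z) = w}. c z)"
      using that by (auto simp: move_cost_def)
    also have "\<dots> = ?C" using that finite_sites by (intro sum.group) auto
    finally show ?thesis .
  qed
  have "(\<Sum>i\<in>S \<times> S. weight r i * (\<Sum>z\<in>S. move_cost r c i z))
     = (\<Sum>x\<in>S. weight r (x, x) * (?C - ?d * (2 - ?d) * c x)) + (\<Sum>x\<in>S. \<Sum>y\<in>S - {x}. weight r (x, y) * ?C)"
    unfolding sum_pairs sum.distrib by (intro arg_cong2[where f="(+)"] sum.cong refl) (auto simp: diag off)
  also have "\<dots> = (1 - total_rate / r) / card S * (card S * ?C - ?d * (2 - ?d) * ?C) + total_rate / r * ?C"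
    unfolding sum_weight_diag sum_weight_off by (simp add: sum_subtractf flip: sum_distrib_left)
  also have "\<dots> = ((1 - total_rate / r) - ((1 - total_rate / r) * ?d) * (2 - ?d) / card S + total_rate / r) * ?C"
  proof -
    have linear: "A / N * (N * C - d * (2 - d) * C) + e * C = (A - (A * d) * (2 - d) / N + e) * C"
      if "N \<noteq> 0" for A N C d e :: real
      using that by (simp add: algebra_simps diff_divide_distrib add_divide_distrib)
    show ?thesis by (rule linear) (use card_pos in simp)
  qed
  also have "\<dots> = contraction_factor r * ?C"
    unfolding weight_noise contraction_factor_def using card_pos by simp
  finally show ?thesis .
qed

lemma unif_eq_mixture:
  assumes \<eta>: "\<eta> \<in> \<Omega>"
  shows "unif r (\<lambda>\<eta>. K \<eta> \<xi>) \<eta> = (\<Sum>i\<in>S \<times> S. weight r i * move r K i \<eta> \<xi>)"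
proof -
  let ?d = "noise r" and ?F = "\<lambda>\<eta>. K \<eta> \<xi>"
  have relabel: "(\<lambda>z\<in>S. \<eta> (if z = x then y else z)) = \<eta>(x := \<eta> y)" if "x \<in> S" for x y
    using \<eta> that by (auto simp: configs_def fun_eq_iff PiE_def extensional_def)
  have off: "(\<Sum>x\<in>S. \<Sum>y\<in>S - {x}. weight r (x, y) * move r K (x, y) \<eta> \<xi>)
     = (\<Sum>x\<in>S. \<Sum>y\<in>S - {x}. q x y * (?F (\<eta>(x := \<eta> y)) - ?F \<eta>)) / r + total_rate / r * ?F \<eta>"
  proof -
    have "(\<Sum>x\<in>S. \<Sum>y\<in>S - {x}. weight r (x, y) * move r K (x, y) \<eta> \<xi>)
      = (\<Sum>x\<in>S. \<Sum>y\<in>S - {x}. q x y * (?F (\<eta>(x := \<eta> y)) - ?F \<eta>) / r + weight r (x, y) * ?F \<eta>)"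
      by (intro sum.cong refl) (auto simp: weight_def move_def relabel diff_divide_distrib algebra_simps)
    then show ?thesis by (simp only: sum.distrib sum_weight_off sum_divide_distrib)
  qed
  have "(\<Sum>x\<in>S. weight r (x, x) * move r K (x, x) \<eta> \<xi>)
     = (1 - total_rate / r) / card S * (\<Sum>x\<in>S. ?F \<eta> + ?d * (\<Sum>b\<in>{0, 1}. 1 / 2 * (?F (\<eta>(x := b)) - ?F \<eta>)))"
    unfolding sum_weight_diag[symmetric] by (intro sum.cong refl) (auto simp: move_def algebra_simps)
  also have "\<dots> = (1 - total_rate / r) * ?F \<eta> + ((1 - total_rate / r) * ?d) / card S
      * (\<Sum>x\<in>S. \<Sum>b\<in>{0, 1}. 1 / 2 * (?F (\<eta>(x := b)) - ?F \<eta>))"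
    unfolding sum.distrib sum_distrib_left[symmetric] using card_pos by (simp add: distrib_left)
  also have "\<dots> = (1 - total_rate / r) * ?F \<eta> + (\<Sum>x\<in>S. \<Sum>b\<in>{0, 1}. 1 / 2 * (?F (\<eta>(x := b)) - ?F \<eta>)) / r"
    unfolding weight_noise using card_pos by simp
  finally have diag: "(\<Sum>x\<in>S. weight r (x, x) * move r K (x, x) \<eta> \<xi>) = \<dots>" .
  have "(\<Sum>i\<in>S \<times> S. weight r i * move r K i \<eta> \<xi>) = ?F \<eta> + gen ?F \<eta> / r"
    unfolding sum_pairs sum.distrib off diag gen_voter[OF \<eta>] add_divide_distrib
    by (simp add: left_diff_distrib)
  then show ?thesis by (simp add: unif_def)
qed

lemma uniformizing_r: "uniformizing r"
proof -
  have "(\<Sum>\<xi>\<in>\<Omega> - {\<eta>}. voter_rate S q \<eta> \<xi>) \<le> r" if \<eta>: "\<eta> \<in> \<Omega>" for \<eta>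
  proof -
    let ?F = "\<lambda>\<xi>. of_bool (\<xi> \<noteq> \<eta>) :: real"
    have "(\<Sum>\<xi>\<in>\<Omega> - {\<eta>}. voter_rate S q \<eta> \<xi>) = gen ?F \<eta>"
      unfolding gen_eq[OF \<eta>] by (intro sum.cong) auto
    also have "\<dots> \<le> (\<Sum>x\<in>S. (\<Sum>y\<in>S - {x}. q x y * 1) + (\<Sum>b\<in>{0, 1 :: nat}. 1 / 2 * 1))"
      unfolding gen_voter[OF \<eta>] using q_nonneg by (intro sum_mono add_mono mult_left_mono) auto
    also have "\<dots> = total_rate + card S" by (simp add: sum.distrib total_rate_def)
    finally show ?thesis using r by simp
  qed
  then show ?thesis using r_pos by (simp add: uniformizing_def)
qed

lemma blockwise_move:
  assumes "blockwise S c K" "i \<in> S \<times> S"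
  shows "blockwise S (move_cost r c i) (move r K i)"
proof -
  obtain x y where i: "i = (x, y)" "x \<in> S" "y \<in> S" using assms(2) by blast
  show ?thesis
  proof (cases "x = y")
    case True
    then show ?thesis using blockwise_noise[OF finite_sites i(2) noise_range assms(1)]
      by (simp add: i(1) move_def move_cost_def)
  next
    case False
    have "(\<lambda>z. if z = x then y else z) \<in> S \<rightarrow> S" using i by auto
    from blockwise_relabel[OF finite_sites this assms(1)] show ?thesis
      using False by (simp add: i(1) move_def move_cost_def)
  qed
qed

text \<open>
  Induction over the number of steps, with the kernel generalized: the first step taken from the
  initial configuration is absorbed into the kernel, which becomes a mixture of kernels of the
  same kind, and the remaining steps act on each of them separately.
\<close>

lemma unif_pow_affinity:
  assumes "blockwise S c K" "\<eta> \<in> \<Omega>" "\<eta>' \<in> \<Omega>"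
  shows "1 - contraction_factor r ^ m * (\<Sum>z\<in>S. c z) \<le>
    affinity \<Omega> (\<lambda>\<xi>. (unif r ^^ m) (\<lambda>\<eta>. K \<eta> \<xi>) \<eta>) (\<lambda>\<xi>. (unif r ^^ m) (\<lambda>\<eta>. K \<eta> \<xi>) \<eta>')"
  using assms(1)
proof (induction m arbitrary: c K)
  case 0
  then show ?case using blockwise_affinity[OF finite_sites 0 assms(2,3)] by simp
next
  case (Suc m)
  let ?P = "\<lambda>i \<zeta> \<xi>. (unif r ^^ m) (\<lambda>\<eta>. move r K i \<eta> \<xi>) \<zeta>"
  have step: "(unif r ^^ Suc m) (\<lambda>\<eta>. K \<eta> \<xi>) \<zeta> = (\<Sum>i\<in>S \<times> S. weight r i * ?P i \<zeta> \<xi>)"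
    if "\<zeta> \<in> \<Omega>" for \<zeta> \<xi>
  proof -
    have "(unif r ^^ Suc m) (\<lambda>\<eta>. K \<eta> \<xi>) \<zeta> = (unif r ^^ m) (unif r (\<lambda>\<eta>. K \<eta> \<xi>)) \<zeta>"
      by (simp add: funpow_swap1)
    also have "\<dots> = (unif r ^^ m) (\<lambda>\<eta>. \<Sum>i\<in>S \<times> S. weight r i * move r K i \<eta> \<xi>) \<zeta>"
      using that by (intro unif_pow_cong unif_eq_mixture)
    finally show ?thesis by (simp only: unif_pow_sum)
  qed
  have nonneg: "0 \<le> ?P i \<zeta> \<xi>" if "i \<in> S \<times> S" "\<zeta> \<in> \<Omega>" "\<xi> \<in> \<Omega>" for i \<zeta> \<xi>
    using that by (intro unif_pow_nonneg uniformizing_r blockwise_nonneg[OF blockwise_move[OF Suc.prems]])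
  have "1 - contraction_factor r ^ Suc m * (\<Sum>z\<in>S. c z)
     = (\<Sum>i\<in>S \<times> S. weight r i) - contraction_factor r ^ m * (\<Sum>i\<in>S \<times> S. weight r i * (\<Sum>z\<in>S. move_cost r c i z))"
    by (simp add: sum_weight sum_move_cost)
  also have "\<dots> = (\<Sum>i\<in>S \<times> S. weight r i * (1 - contraction_factor r ^ m * (\<Sum>z\<in>S. move_cost r c i z)))"
    by (simp only: right_diff_distrib sum_subtractf mult_1_right sum_distrib_left mult.left_commute)
  also have "\<dots> \<le> (\<Sum>i\<in>S \<times> S. weight r i * affinity \<Omega> (?P i \<eta>) (?P i \<eta>'))"
    by (intro sum_mono mult_left_mono Suc.IH blockwise_move Suc.prems weight_nonneg)
  also have "\<dots> \<le> affinity \<Omega> (\<lambda>\<xi>. \<Sum>i\<in>S \<times> S. weight r i * ?P i \<eta> \<xi>) (\<lambda>\<xi>. \<Sum>i\<in>S \<times> S. weight r i * ?P i \<eta>' \<xi>)"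
    using finite_sites assms(2,3) by (intro affinity_superadditive weight_nonneg nonneg) auto
  finally show ?case by (simp only: step[OF assms(2)] step[OF assms(3)])
qed

lemma unif_pow_point_affinity:
  assumes "\<eta> \<in> \<Omega>" "\<eta>' \<in> \<Omega>"
  shows "1 - card S * contraction_factor r ^ m \<le>
    affinity \<Omega> (\<lambda>\<xi>. (unif r ^^ m) (point \<xi>) \<eta>) (\<lambda>\<xi>. (unif r ^^ m) (point \<xi>) \<eta>')"
  using unif_pow_affinity[OF blockwise_identity[OF finite_sites] assms, of m] by (simp add: mult.commute)

end

abbreviation "law \<equiv> transition \<Omega> (voter_rate S q)"

text \<open>
  Letting \<open>r\<close> tend to infinity removes the error \<open>noise r\<close> in the
  exponential rate.
\<close>

lemma affinity_law:
  assumes "\<eta> \<in> \<Omega>" "\<eta>' \<in> \<Omega>" "0 \<le> t"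
  shows "1 - card S * exp (- 2 * t) \<le> affinity \<Omega> (law t \<eta>) (law t \<eta>')"
proof -
  have bound: "1 - card S * exp (- ((2 - noise r) * t)) \<le> affinity \<Omega> (law t \<eta>) (law t \<eta>')"
    if r: "total_rate + card S \<le> r" for r
  proof -
    have "r * (1 - contraction_factor r) = 2 - noise r"
      using r_pos[OF r] by (simp add: contraction_factor_def)
    then show ?thesis
      using affinity_transition[OF uniformizing_r[OF r] assms(1,2,3) unif_pow_point_affinity[OF r assms(1,2)]]
      by (simp only:)
  qed
  have "(noise \<longlongrightarrow> 0) at_top"
  proof -
    have "((\<lambda>r. 1 / (r - a)) \<longlongrightarrow> 0) at_top" for a :: real by real_asymp
    note this[of total_rate]
    from tendsto_mult_right_zero[OF this, of "real (card S)"] show ?thesis by (simp add: noise_def[abs_def])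
  qed
  then have "((\<lambda>r. 1 - card S * exp (- ((2 - noise r) * t))) \<longlongrightarrow> 1 - card S * exp (- ((2 - 0) * t))) at_top"
    by (intro tendsto_intros)
  then have "1 - card S * exp (- ((2 - 0) * t)) \<le> affinity \<Omega> (law t \<eta>) (law t \<eta>')"
    by (rule tendsto_upperbound) (auto intro: eventually_mono[OF eventually_ge_at_top bound])
  then show ?thesis by simp
qed

lemma tv_law:
  assumes "\<eta> \<in> \<Omega>" "\<eta>' \<in> \<Omega>" "0 \<le> t"
  shows "tv_dist \<Omega> (law t \<eta>) (law t \<eta>') \<le> sqrt (2 * (card S * exp (- 2 * t)))"
  using affinity_law[OF assms] assms
  by (intro tv_dist_le_affinity transition_nonneg sum_transition) auto

lemma stationary_ex1: "\<exists>!p. stationary \<Omega> (voter_rate S q) p"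
proof (rule ex_ex1I)
  define r where "r = total_rate + card S + 2"
  have r: "total_rate + card S \<le> r" by (simp add: r_def)
  define l where "l = contraction_factor r"
  have r2: "r > 2" using total_rate_nonneg card_pos by (simp add: r_def)
  have l: "0 \<le> l" "l < 1"
    using noise_range[OF r] r2 by (simp_all add: l_def contraction_factor_def)
  show "\<exists>p. stationary \<Omega> (voter_rate S q) p"
  proof (rule stationary_exists[OF uniformizing_r[OF r] configs_nonempty])
    have "(\<lambda>m. 2 * sqrt (2 * (real (card S) * l ^ m))) \<longlonglongrightarrow> 2 * sqrt (2 * (real (card S) * 0))"
      by (intro tendsto_mult tendsto_const tendsto_real_sqrt LIMSEQ_realpow_zero l)
    then show "(\<lambda>m. 2 * sqrt (2 * (card S * l ^ m))) \<longlonglongrightarrow> 0" by simp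
  next
    fix m \<eta> \<eta>' \<xi> assume \<eta>: "\<eta> \<in> \<Omega>" "\<eta>' \<in> \<Omega>" and \<xi>: "\<xi> \<in> \<Omega>"
    let ?p = "\<lambda>\<xi>. (unif r ^^ m) (point \<xi>) \<eta>" and ?p' = "\<lambda>\<xi>. (unif r ^^ m) (point \<xi>) \<eta>'"
    have one: "(\<Sum>\<xi>\<in>\<Omega>. (unif r ^^ m) (point \<xi>) \<zeta>) = 1" if "\<zeta> \<in> \<Omega>" for \<zeta>
      using sum_unif_pow_point[OF that, where F="\<lambda>_. 1" and c=r and m=m] by (simp add: unif_pow_const that)
    have "tv_dist \<Omega> ?p ?p' \<le> sqrt (2 * (card S * l ^ m))"
      using unif_pow_point_affinity[OF r \<eta>, of m] \<eta>
      by (intro tv_dist_le_affinity one unif_pow_nonneg uniformizing_r[OF r]) (auto simp: l_def)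
    moreover have "\<bar>?p \<xi> - ?p' \<xi>\<bar> \<le> 2 * tv_dist \<Omega> ?p ?p'"
      unfolding tv_dist_def using finite_configs \<xi>
        member_le_sum[of \<xi> \<Omega> "\<lambda>\<xi>. \<bar>?p \<xi> - ?p' \<xi>\<bar>"] by simp
    ultimately show "\<bar>?p \<xi> - ?p' \<xi>\<bar> \<le> 2 * sqrt (2 * (card S * l ^ m))" by linarith
  qed
next
  fix p p' assume p: "stationary \<Omega> (voter_rate S q) p" "stationary \<Omega> (voter_rate S q) p'"
  have "((\<lambda>t :: real. exp (- 2 * t)) \<longlongrightarrow> 0) at_top" by real_asymp
  then have "((\<lambda>t. sqrt (2 * (real (card S) * exp (- 2 * t)))) \<longlongrightarrow> sqrt (2 * (real (card S) * 0))) at_top"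
    by (intro tendsto_mult tendsto_const tendsto_real_sqrt)
  then have "((\<lambda>t. sqrt (2 * (real (card S) * exp (- 2 * t)))) \<longlongrightarrow> 0) at_top" by simp
  then show "p = p'" using tv_law by (intro stationary_unique[OF p]) auto
qed

lemma stationary_voter: "stationary \<Omega> (voter_rate S q) (voter_stationary S q)"
  unfolding voter_stationary_def by (rule theI'[OF stationary_ex1])

lemma voter_tv_le:
  assumes "\<eta> \<in> \<Omega>" "0 \<le> t"
  shows "voter_tv S q \<eta> t \<le> sqrt (2 * card S) * exp (- t)"
proof -
  have "voter_tv S q \<eta> t \<le> sqrt (2 * (card S * exp (- 2 * t)))"
    unfolding voter_tv_def voter_law_def
    by (intro tv_stationary_le stationary_voter assms tv_law)
  also have "\<dots> = sqrt (2 * card S) * sqrt ((exp (- t))\<^sup>2)"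
    by (simp add: real_sqrt_mult flip: exp_of_nat_mult)
  finally show ?thesis by simp
qed

lemma voter_tv_le_1:
  assumes "\<eta> \<in> \<Omega>" "0 \<le> t"
  shows "voter_tv S q \<eta> t \<le> 1"
proof -
  have "(\<Sum>\<xi>\<in>\<Omega>. pmf (voter_stationary S q) \<xi>) = 1"
    using stationary_voter finite_configs by (intro sum_pmf_eq_1) (auto simp: stationary_def)
  moreover have "(\<Sum>\<xi>\<in>\<Omega>. \<bar>law t \<eta> \<xi> - pmf (voter_stationary S q) \<xi>\<bar>)
      \<le> (\<Sum>\<xi>\<in>\<Omega>. law t \<eta> \<xi> + pmf (voter_stationary S q) \<xi>)"
    using transition_nonneg assms by (intro sum_mono) (auto simp: abs_le_iff add_increasing)
  ultimately show ?thesis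
    by (simp add: voter_tv_def voter_law_def tv_dist_def sum.distrib sum_transition assms)
qed

lemma voter_tv_max_ge: "\<eta> \<in> \<Omega> \<Longrightarrow> voter_tv S q \<eta> t \<le> voter_tv_max S q t"
  unfolding voter_tv_max_def using finite_configs by (intro Max_ge) auto

lemma voter_tv_max_le:
  assumes "0 \<le> t"
  shows "voter_tv_max S q t \<le> sqrt (2 * card S) * exp (- t)"
  unfolding voter_tv_max_def using finite_configs configs_nonempty voter_tv_le assms by simp

lemma voter_tv_max_nonneg: "0 \<le> voter_tv_max S q t"
proof -
  obtain \<eta> where "\<eta> \<in> \<Omega>" using configs_nonempty by blast
  moreover have "0 \<le> voter_tv S q \<eta> t" by (simp add: voter_tv_def tv_dist_def sum_nonneg)
  ultimately show ?thesis using voter_tv_max_ge[of \<eta> t] by linarith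
qed

section \<open>Lower bound by a second moment\<close>

text \<open>
  Chebyshev's inequality for \<open>\<Phi>\<close>, at the threshold halfway between its
  stationary mean 0 and its mean \<open>exp (- t)\<close> at time \<open>t\<close>. The
  constants: \<open>R\<close> bounds the rate at which \<open>\<Phi>\<close> gains quadratic
  variation, the variance at time \<open>t\<close> and the stationary one are at most
  \<open>R / 2\<close>, and the two error probabilities add up to at most
  \<open>4 * R * exp (2 * t)\<close>.
\<close>

lemma voter_tv_ge:
  assumes p: "stationary S q p" and M: "\<And>x. x \<in> S \<Longrightarrow> pmf p x \<le> M"
    and Q: "\<And>x. x \<in> S \<Longrightarrow> (\<Sum>y\<in>S - {x}. q x y) \<le> Q" and t: "0 \<le> t"
  shows "1 - 16 * (Q + 1 / 2) * M * exp (2 * t) \<le> voter_tv S q (all_ones S) t"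
proof -
  interpret site: rates S q
    by (rule rates.intro[OF finite_sites q_nonneg])
  let ?p = "pmf p"
  have p1: "(\<Sum>x\<in>S. ?p x) = 1"
    using p finite_sites by (intro sum_pmf_eq_1) (auto simp: stationary_def)
  have Q0: "0 \<le> Q"
  proof -
    obtain x where x: "x \<in> S" using sites_nonempty by blast
    have "0 \<le> (\<Sum>y\<in>S - {x}. q x y)" using x by (intro sum_nonneg q_nonneg) auto
    then show ?thesis using Q[OF x] by simp
  qed
  have M0: "0 \<le> M"
  proof -
    obtain x where x: "x \<in> S" using sites_nonempty by blast
    show ?thesis using M[OF x] pmf_nonneg[of p x] by linarith
  qed
  define \<Phi> where "\<Phi> \<eta> = (\<Sum>x\<in>S. ?p x * (2 * real (\<eta> x) - 1))" for \<eta>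
  have jump: "\<Phi> (\<eta>(x := b)) - \<Phi> \<eta> = 2 * ?p x * (real b - real (\<eta> x))" if "x \<in> S" for \<eta> x b
  proof -
    have "(\<Sum>z\<in>S - {x}. ?p z * (2 * real ((\<eta>(x := b)) z) - 1)) = (\<Sum>z\<in>S - {x}. ?p z * (2 * real (\<eta> z) - 1))"
      by (intro sum.cong) auto
    then show ?thesis
      unfolding \<Phi>_def sum.remove[OF finite_sites that] by (simp add: algebra_simps)
  qed
  \<comment> \<open>By stationarity of \<open>p\<close>, the contributions of the voting moves to the drift of \<open>\<Phi>\<close> cancel.\<close>
  have bal: "(\<Sum>x\<in>S. ?p x * (\<Sum>y\<in>S - {x}. q x y * (real (\<eta> y) - real (\<eta> x)))) = 0" for \<eta> :: "'a \<Rightarrow> nat"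
    using site.stationary_gen[OF p, of "\<lambda>x. real (\<eta> x)"] by (simp add: site.gen_eq cong: sum.cong)
  have gen1: "gen \<Phi> \<eta> = - 1 * \<Phi> \<eta>" if \<eta>: "\<eta> \<in> \<Omega>" for \<eta>
  proof -
    have "gen \<Phi> \<eta> = (\<Sum>x\<in>S. 2 * (?p x * (\<Sum>y\<in>S - {x}. q x y * (real (\<eta> y) - real (\<eta> x))))
       - ?p x * (2 * real (\<eta> x) - 1))"
      unfolding gen_voter[OF \<eta>]
    proof (intro sum.cong refl)
      fix x assume x: "x \<in> S"
      have "(\<Sum>y\<in>S - {x}. q x y * (\<Phi> (\<eta>(x := \<eta> y)) - \<Phi> \<eta>))
        = 2 * (?p x * (\<Sum>y\<in>S - {x}. q x y * (real (\<eta> y) - real (\<eta> x))))"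
        by (simp add: jump[OF x] sum_distrib_left mult.left_commute mult.assoc)
      then show "(\<Sum>y\<in>S - {x}. q x y * (\<Phi> (\<eta>(x := \<eta> y)) - \<Phi> \<eta>)) + (\<Sum>b\<in>{0, 1}. 1 / 2 * (\<Phi> (\<eta>(x := b)) - \<Phi> \<eta>))
        = 2 * (?p x * (\<Sum>y\<in>S - {x}. q x y * (real (\<eta> y) - real (\<eta> x)))) - ?p x * (2 * real (\<eta> x) - 1)"
        by (simp add: jump[OF x] algebra_simps)
    qed
    also have "\<dots> = - \<Phi> \<eta>"
      unfolding sum_subtractf sum_distrib_left[symmetric] bal by (simp add: \<Phi>_def)
    finally show ?thesis by simp
  qed
  define R where "R = 4 * (Q + 1 / 2) * M"
  have R0: "0 \<le> R" using Q0 M0 by (simp add: R_def)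
  \<comment> \<open>The remainder in \<open>L (\<Phi>\<^sup>2) = 2 * \<Phi> * L \<Phi> + (quadratic variation)\<close> collects squared jumps \<open>(2 * p x)\<^sup>2 \<le> 4 * M * p x\<close>, and \<open>p\<close> sums to 1.\<close>
  have gen2: "gen (\<lambda>\<eta>. (\<Phi> \<eta>)\<^sup>2) \<eta> \<le> - 2 * (\<Phi> \<eta>)\<^sup>2 + R" if \<eta>: "\<eta> \<in> \<Omega>" for \<eta>
  proof -
    have sq: "a\<^sup>2 - b\<^sup>2 = 2 * b * (a - b) + (a - b)\<^sup>2" for a b :: real
      by (simp add: power2_eq_square algebra_simps)
    have val: "\<eta> y = 0 \<or> \<eta> y = 1" if "y \<in> S" for y using configs_val[OF \<eta> that] by simp
    have "gen (\<lambda>\<eta>. (\<Phi> \<eta>)\<^sup>2) \<eta> = 2 * \<Phi> \<eta> * gen \<Phi> \<eta>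
       + (\<Sum>x\<in>S. (\<Sum>y\<in>S - {x}. q x y * (\<Phi> (\<eta>(x := \<eta> y)) - \<Phi> \<eta>)\<^sup>2)
         + (\<Sum>b\<in>{0, 1}. 1 / 2 * (\<Phi> (\<eta>(x := b)) - \<Phi> \<eta>)\<^sup>2))"
      unfolding gen_voter[OF \<eta>] sq sum_distrib_left sum.distrib[symmetric] distrib_left
      by (intro sum.cong refl) (simp add: sum.distrib sum_subtractf sum_distrib_left algebra_simps)
    also have "\<dots> \<le> - 2 * (\<Phi> \<eta>)\<^sup>2 + (\<Sum>x\<in>S. 4 * (Q + 1 / 2) * M * ?p x)"
    proof (intro add_mono sum_mono)
      show "2 * \<Phi> \<eta> * gen \<Phi> \<eta> \<le> - 2 * (\<Phi> \<eta>)\<^sup>2" by (simp add: gen1[OF \<eta>] power2_eq_square)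
      fix x assume x: "x \<in> S"
      have le: "(real (\<eta> y) - real (\<eta> x))\<^sup>2 \<le> 1" if "y \<in> S" for y
        using val[OF that] val[OF x] by auto
      have "(\<Sum>y\<in>S - {x}. q x y * (\<Phi> (\<eta>(x := \<eta> y)) - \<Phi> \<eta>)\<^sup>2) \<le> (\<Sum>y\<in>S - {x}. q x y * (4 * (?p x)\<^sup>2))"
      proof (intro sum_mono mult_left_mono)
        fix y assume y: "y \<in> S - {x}"
        have "(2 * ?p x)\<^sup>2 * (real (\<eta> y) - real (\<eta> x))\<^sup>2 \<le> (2 * ?p x)\<^sup>2 * 1"
          using y by (intro mult_left_mono le) auto
        then show "(\<Phi> (\<eta>(x := \<eta> y)) - \<Phi> \<eta>)\<^sup>2 \<le> 4 * (?p x)\<^sup>2"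
          by (simp add: jump[OF x] power_mult_distrib)
        show "0 \<le> q x y" using x y by (intro q_nonneg) auto
      qed
      also have "\<dots> = (\<Sum>y\<in>S - {x}. q x y) * (4 * (?p x)\<^sup>2)" by (simp add: sum_distrib_right)
      also have "\<dots> \<le> Q * (4 * (?p x)\<^sup>2)" by (intro mult_right_mono Q x) auto
      finally have 1: "(\<Sum>y\<in>S - {x}. q x y * (\<Phi> (\<eta>(x := \<eta> y)) - \<Phi> \<eta>)\<^sup>2) \<le> Q * (4 * (?p x)\<^sup>2)" .
      have 2: "(\<Sum>b\<in>{0, 1}. 1 / 2 * (\<Phi> (\<eta>(x := b)) - \<Phi> \<eta>)\<^sup>2) = 1 / 2 * (4 * (?p x)\<^sup>2)"
        using val[OF x] by (auto simp: jump[OF x] power_mult_distrib)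
      have "(Q + 1 / 2) * (4 * (?p x)\<^sup>2) \<le> (Q + 1 / 2) * (4 * (M * ?p x))"
        using M[OF x] Q0 by (intro mult_left_mono) (auto simp: power2_eq_square intro!: mult_right_mono)
      then show "(\<Sum>y\<in>S - {x}. q x y * (\<Phi> (\<eta>(x := \<eta> y)) - \<Phi> \<eta>)\<^sup>2)
         + (\<Sum>b\<in>{0, 1}. 1 / 2 * (\<Phi> (\<eta>(x := b)) - \<Phi> \<eta>)\<^sup>2) \<le> 4 * (Q + 1 / 2) * M * ?p x"
        using 1 unfolding 2 by (simp add: algebra_simps)
    qed
    also have "(\<Sum>x\<in>S. 4 * (Q + 1 / 2) * M * ?p x) = R"
      unfolding sum_distrib_left[symmetric] p1 R_def by simp
    finally show ?thesis .
  qed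
  let ?\<mu> = "exp (- t)" and ?ones = "all_ones S" and ?s = "pmf (voter_stationary S q)"
  have one: "?ones \<in> \<Omega>" by (auto simp: all_ones_def configs_def)
  have \<Phi>1: "\<Phi> ?ones = 1" using p1 by (simp add: \<Phi>_def all_ones_def)
  have s1: "(\<Sum>\<eta>\<in>\<Omega>. ?s \<eta>) = 1"
    using stationary_voter finite_configs by (intro sum_pmf_eq_1) (auto simp: stationary_def)
  have l1: "(\<Sum>\<eta>\<in>\<Omega>. law t ?ones \<eta>) = 1" by (rule sum_transition[OF one])
  have l0: "0 \<le> law t ?ones \<eta>" if "\<eta> \<in> \<Omega>" for \<eta> by (intro transition_nonneg one that t)
  define A where "A = {\<eta> \<in> \<Omega>. ?\<mu> / 2 < \<Phi> \<eta>}"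
  have A: "A \<subseteq> \<Omega>" by (auto simp: A_def)
  have var_s: "(\<Sum>\<eta>\<in>\<Omega>. ?s \<eta> * (\<Phi> \<eta>)\<^sup>2) \<le> R / 2"
  proof -
    have "0 = (\<Sum>\<eta>\<in>\<Omega>. ?s \<eta> * gen (\<lambda>\<eta>. (\<Phi> \<eta>)\<^sup>2) \<eta>)"
      using stationary_gen[OF stationary_voter] by simp
    also have "\<dots> \<le> (\<Sum>\<eta>\<in>\<Omega>. ?s \<eta> * (- 2 * (\<Phi> \<eta>)\<^sup>2 + R))"
      by (intro sum_mono mult_left_mono gen2) auto
    also have "\<dots> = - 2 * (\<Sum>\<eta>\<in>\<Omega>. ?s \<eta> * (\<Phi> \<eta>)\<^sup>2) + (\<Sum>\<eta>\<in>\<Omega>. ?s \<eta>) * R"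
      unfolding sum_distrib_left sum_distrib_right sum.distrib[symmetric]
      by (intro sum.cong refl) (simp add: algebra_simps)
    finally show ?thesis using s1 by simp
  qed
  have var_l: "(\<Sum>\<eta>\<in>\<Omega>. law t ?ones \<eta> * (\<Phi> \<eta> - ?\<mu>)\<^sup>2) \<le> R / 2"
  proof -
    have m1: "(\<Sum>\<eta>\<in>\<Omega>. law t ?ones \<eta> * \<Phi> \<eta>) = ?\<mu>"
      using flow_eigen[OF gen1 one, of t] by (simp add: expectation_transition[OF one] \<Phi>1)
    have m2: "(\<Sum>\<eta>\<in>\<Omega>. law t ?ones \<eta> * (\<Phi> \<eta>)\<^sup>2) \<le> exp (- 2 * t) + R / 2"
      using flow_drift[OF gen2 R0 one t] by (simp add: expectation_transition[OF one] \<Phi>1)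
    have "(\<Sum>\<eta>\<in>\<Omega>. law t ?ones \<eta> * (\<Phi> \<eta> - ?\<mu>)\<^sup>2) = (\<Sum>\<eta>\<in>\<Omega>. law t ?ones \<eta> * (\<Phi> \<eta>)\<^sup>2)
       - 2 * ?\<mu> * (\<Sum>\<eta>\<in>\<Omega>. law t ?ones \<eta> * \<Phi> \<eta>) + ?\<mu>\<^sup>2 * (\<Sum>\<eta>\<in>\<Omega>. law t ?ones \<eta>)"
      unfolding sum_distrib_left sum.distrib[symmetric] sum_subtractf[symmetric]
      by (intro sum.cong refl) (simp add: power2_eq_square algebra_simps)
    also have "\<dots> \<le> R / 2"
    proof -
      have "?\<mu>\<^sup>2 = exp (- 2 * t)" by (simp flip: exp_of_nat_mult)
      then show ?thesis using m2 unfolding m1 l1 by (simp add: power2_eq_square)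
    qed
    finally show ?thesis .
  qed
  have cheb: "sum w B \<le> 2 * R * exp (2 * t)"
    if B: "B \<subseteq> \<Omega>" and w: "\<And>\<eta>. \<eta> \<in> \<Omega> \<Longrightarrow> 0 \<le> w \<eta>" and far: "\<And>\<eta>. \<eta> \<in> B \<Longrightarrow> ?\<mu> / 2 \<le> \<bar>G \<eta>\<bar>"
      and var: "(\<Sum>\<eta>\<in>\<Omega>. w \<eta> * (G \<eta>)\<^sup>2) \<le> R / 2" for w G :: "('a \<Rightarrow> nat) \<Rightarrow> real" and B
  proof -
    have "sum w B * (?\<mu> / 2)\<^sup>2 \<le> (\<Sum>\<eta>\<in>B. w \<eta> * (G \<eta>)\<^sup>2)"
      unfolding sum_distrib_right using B w far
      by (intro sum_mono mult_left_mono) (auto intro: power2_le_iff_abs_le[THEN iffD2] simp: abs_le_square_iff[symmetric])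
    also have "\<dots> \<le> (\<Sum>\<eta>\<in>\<Omega>. w \<eta> * (G \<eta>)\<^sup>2)"
      using finite_configs B w by (intro sum_mono2) auto
    finally have "sum w B * (?\<mu> / 2)\<^sup>2 \<le> R / 2" using var by simp
    then have "sum w B * (?\<mu> / 2)\<^sup>2 * (4 * exp (2 * t)) \<le> R / 2 * (4 * exp (2 * t))"
      by (intro mult_right_mono) auto
    moreover have "(?\<mu> / 2)\<^sup>2 * (4 * exp (2 * t)) = 1"
      by (simp add: power_divide flip: exp_of_nat_mult exp_add)
    ultimately show ?thesis by (simp add: mult.assoc)
  qed
  have "sum ?s A \<le> 2 * R * exp (2 * t)"
    by (rule cheb[OF A _ _ var_s]) (auto simp: A_def)
  moreover have "sum (law t ?ones) (\<Omega> - A) \<le> 2 * R * exp (2 * t)"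
  proof (rule cheb[OF _ l0 _ var_l])
    fix \<eta> assume "\<eta> \<in> \<Omega> - A"
    then have "\<Phi> \<eta> \<le> ?\<mu> / 2" by (auto simp: A_def not_less)
    then show "?\<mu> / 2 \<le> \<bar>\<Phi> \<eta> - ?\<mu>\<bar>" using abs_ge_minus_self[of "\<Phi> \<eta> - ?\<mu>"] by linarith
  qed auto
  moreover have "sum (law t ?ones) (\<Omega> - A) = 1 - sum (law t ?ones) A"
    using l1 A finite_configs by (simp add: sum_diff)
  moreover have "sum (law t ?ones) A - sum ?s A \<le> voter_tv S q ?ones t"
    unfolding voter_tv_def voter_law_def using l1 s1
    by (intro tv_dist_ge_event finite_configs A) simp
  ultimately show ?thesis by (simp add: R_def algebra_simps)
qed

end

text \<open>
  The smallest point mass is at most the average \<open>1 / card S\<close>.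
\<close>

lemma stationary_almost_uniform:
  assumes S: "finite S" "S \<noteq> {}" and p: "stationary S q p" "\<forall>x\<in>S. 0 < pmf p x"
    and C: "Max (pmf p ` S) / Min (pmf p ` S) \<le> C" and x: "x \<in> S"
  shows "pmf p x \<le> C / card S"
proof -
  let ?m = "Min (pmf p ` S)" and ?M = "Max (pmf p ` S)"
  have m: "0 < ?m" using S p(2) by simp
  have "card S * ?m \<le> (\<Sum>x\<in>S. pmf p x)"
    using S by (intro sum_bounded_below) simp
  also have "\<dots> = 1" using p(1) S by (intro sum_pmf_eq_1) (auto simp: stationary_def)
  finally have cm: "card S * ?m \<le> 1" .
  have le: "pmf p x \<le> ?M" using S x by (intro Max_ge) auto
  also have "?M \<le> C * ?m" using C m by (simp add: field_simps)
  finally have "pmf p x \<le> C * ?m" .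
  then have C0: "0 \<le> C" using m pmf_nonneg[of p x] zero_le_mult_iff[of C ?m] by linarith
  have "card S * pmf p x \<le> card S * (C * ?m)" using \<open>pmf p x \<le> C * ?m\<close> by (intro mult_left_mono) auto
  also have "\<dots> = C * (card S * ?m)" by simp
  also have "\<dots> \<le> C" using mult_left_mono[OF cm C0] by simp
  finally show ?thesis using S by (simp add: field_simps card_gt_0_iff)
qed

section \<open>The cutoff\<close>

theorem theorem1:
  fixes S :: "nat \<Rightarrow> 'a set" and q :: "nat \<Rightarrow> 'a \<Rightarrow> 'a \<Rightarrow> real" and C :: real
  assumes "\<And>n. finite (S n)"
    and "\<And>n. card (S n) \<ge> 2"
    and "\<And>n x y. x \<in> S n \<Longrightarrow> y \<in> S n \<Longrightarrow> x \<noteq> y \<Longrightarrow> q n x y \<ge> 0"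
    and "filterlim (\<lambda>n. card (S n)) at_top sequentially"
    and "bdd_above (range (\<lambda>n. qmax (S n) (q n)))"
    and "\<And>n. \<exists>p. stationary (S n) (q n) p \<and> (\<forall>x\<in>S n. 0 < pmf p x) \<and>
               Max (pmf p ` S n) / Min (pmf p ` S n) \<le> C"
  shows "(\<forall>\<epsilon>. 0 < \<epsilon> \<and> \<epsilon> < 1 \<longrightarrow>
            (\<lambda>n. tmix (S n) (q n) \<epsilon>) \<sim>[sequentially] (\<lambda>n. 1 / 2 * ln (real (card (S n))))) \<and>
         ((\<lambda>\<alpha>::real. liminf (\<lambda>n. ereal
              (voter_tv (S n) (q n) (all_ones (S n)) (1 / 2 * ln (real (card (S n))) - \<alpha>))))
            \<longlongrightarrow> 1) at_top \<and>
         ((\<lambda>\<alpha>::real. limsup (\<lambda>n. ereal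
              (voter_tv_max (S n) (q n) (1 / 2 * ln (real (card (S n))) + \<alpha>))))
            \<longlongrightarrow> 0) at_top"
proof -
  define N where "N n = real (card (S n))" for n
  have N2: "2 \<le> N n" for n using assms(2)[of n] by (simp add: N_def)
  have Npos: "0 < N n" for n using N2[of n] by simp
  have lnN: "0 \<le> ln (N n)" for n using N2[of n] by simp
  have Nlim: "filterlim N at_top sequentially"
    unfolding N_def by (rule filterlim_compose[OF filterlim_real_sequentially assms(4)])
  have voter: "voter (S n) (q n)" for n
    using assms(1,3) assms(2)[of n] by unfold_locales auto
  define f where "f n t = voter_tv_max (S n) (q n) t" for n t
  define g where "g n t = voter_tv (S n) (q n) (all_ones (S n)) t" for n t
  have ones: "all_ones (S n) \<in> configs (S n)" for n by (auto simp: all_ones_def configs_def)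
  obtain Q where Q: "\<And>n. qmax (S n) (q n) \<le> Q" using assms(5) by (auto simp: bdd_above_def)
  define K where "K = max 1 (16 * (Q + 1 / 2) * C)"
  have Kpos: "0 < K" by (simp add: K_def)
  have upper: "f n t \<le> sqrt 2 * (sqrt (N n) * exp (- t))" if "0 \<le> t" for n t
    using voter.voter_tv_max_le[OF voter that, of n] by (simp add: f_def N_def real_sqrt_mult mult.assoc)
  have lower: "1 - K * (exp (2 * t) / N n) \<le> g n t" if t: "0 \<le> t" for n t
  proof -
    obtain p where p: "stationary (S n) (q n) p" "\<forall>x\<in>S n. 0 < pmf p x"
      "Max (pmf p ` S n) / Min (pmf p ` S n) \<le> C" using assms(6)[of n] by blast
    have ne: "S n \<noteq> {}" using assms(2)[of n] by auto
    have "(\<Sum>y\<in>S n - {x}. q n x y) \<le> Q" if "x \<in> S n" for x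
    proof -
      have "(\<Sum>y\<in>S n - {x}. q n x y) \<le> qmax (S n) (q n)"
        unfolding qmax_def using assms(1)[of n] that by (intro Max_ge) auto
      then show ?thesis using Q[of n] by linarith
    qed
    then have "1 - 16 * (Q + 1 / 2) * (C / N n) * exp (2 * t) \<le> g n t"
      unfolding g_def N_def using stationary_almost_uniform[OF assms(1) ne p] t
      by (intro voter.voter_tv_ge[OF voter p(1)]) auto
    moreover have "16 * (Q + 1 / 2) * C * (exp (2 * t) / N n) \<le> K * (exp (2 * t) / N n)"
      using Npos[of n] by (intro mult_right_mono) (auto simp: K_def)
    ultimately show ?thesis by simp
  qed
  have gf: "g n t \<le> f n t" for n t
    unfolding f_def g_def by (rule voter.voter_tv_max_ge[OF voter ones])
  have g1: "g n t \<le> 1" if "0 \<le> t" for n t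
    unfolding g_def by (rule voter.voter_tv_le_1[OF voter ones that])
  have f0: "0 \<le> f n t" for n t
    unfolding f_def by (rule voter.voter_tv_max_nonneg[OF voter])
  \<comment> \<open>At \<open>1 / 2 * ln (N n)\<close> plus a constant, the number of sites cancels from both bounds.\<close>
  have early: "exp (2 * (1 / 2 * ln (N n) - \<alpha>)) / N n = exp (- 2 * \<alpha>)" for n \<alpha>
  proof -
    have "2 * (1 / 2 * ln (N n) - \<alpha>) = ln (N n) + - 2 * \<alpha>" by simp
    then show ?thesis using Npos[of n] by (simp only: exp_add) simp
  qed
  have late: "sqrt (N n) * exp (- (1 / 2 * ln (N n) + \<alpha>)) = exp (- \<alpha>)" for n \<alpha>
  proof -
    have "1 / 2 * ln (N n) = ln (sqrt (N n))" using Npos[of n] by (simp add: ln_sqrt)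
    then have "exp (1 / 2 * ln (N n)) = sqrt (N n)" using Npos[of n] by simp
    then have "sqrt (N n) * exp (- (1 / 2 * ln (N n) + \<alpha>))
        = exp (1 / 2 * ln (N n) + - (1 / 2 * ln (N n) + \<alpha>))"
      by (simp only: exp_add)
    then show ?thesis by simp
  qed
  have "(\<lambda>n. tmix (S n) (q n) \<epsilon>) \<sim>[sequentially] (\<lambda>n. 1 / 2 * ln (N n))"
    if \<epsilon>: "0 < \<epsilon>" "\<epsilon> < 1" for \<epsilon>
  proof -
    define T where "T n = {t. 0 \<le> t \<and> f n t \<le> \<epsilon>}" for n
    \<comment> \<open>The constants \<open>a\<close> and \<open>b\<close> solve \<open>sqrt 2 * exp (- a) = \<epsilon>\<close> and \<open>1 - K * exp (2 * b) = \<epsilon>\<close>.\<close>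
    define a where "a = ln (sqrt 2 / \<epsilon>)"
    define b where "b = 1 / 2 * ln ((1 - \<epsilon>) / K)"
    have "\<epsilon> \<le> sqrt 2" using \<epsilon>(2) real_sqrt_ge_one[of 2] by linarith
    then have "1 \<le> sqrt 2 / \<epsilon>" using \<epsilon> by simp
    then have a0: "0 \<le> a" by (simp add: a_def)
    have mem: "1 / 2 * ln (N n) + a \<in> T n" for n
    proof -
      have t0: "0 \<le> 1 / 2 * ln (N n) + a" using lnN[of n] a0 by simp
      have "f n (1 / 2 * ln (N n) + a) \<le> sqrt 2 * exp (- a)"
        using upper[OF t0, of n] unfolding late .
      also have "\<dots> = \<epsilon>" using \<epsilon> by (simp add: a_def exp_minus)
      finally show ?thesis using t0 by (simp add: T_def)
    qed
    have low: "1 / 2 * ln (N n) + b \<le> t" if "t \<in> T n" for n t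
    proof -
      have "1 - K * (exp (2 * t) / N n) \<le> \<epsilon>"
        using lower[of t n] gf[of n t] that by (simp add: T_def)
      then have "N n * ((1 - \<epsilon>) / K) \<le> exp (2 * t)"
        using Kpos Npos[of n] by (simp add: field_simps)
      then have "ln (N n * ((1 - \<epsilon>) / K)) \<le> ln (exp (2 * t))"
        using Kpos Npos[of n] \<epsilon> by (subst ln_le_cancel_iff) auto
      moreover have "ln (N n * ((1 - \<epsilon>) / K)) = ln (N n) + ln ((1 - \<epsilon>) / K)"
        using Kpos Npos[of n] \<epsilon> by (intro ln_mult_pos) auto
      ultimately show ?thesis by (simp add: b_def)
    qed
    have tmix: "tmix (S n) (q n) \<epsilon> = Inf (T n)" for n by (simp add: tmix_def T_def f_def)
    have "Inf (T n) \<le> 1 / 2 * ln (N n) + a" for n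
      by (rule cInf_lower[OF mem]) (auto simp: T_def intro: bdd_belowI[of _ 0])
    moreover have "1 / 2 * ln (N n) + b \<le> Inf (T n)" for n
      using mem[of n] low by (intro cInf_greatest) auto
    ultimately have bound: "\<bar>tmix (S n) (q n) \<epsilon> - 1 / 2 * ln (N n)\<bar> \<le> \<bar>a\<bar> + \<bar>b\<bar>" for n
      unfolding tmix by (smt (verit))
    have "(\<lambda>n. tmix (S n) (q n) \<epsilon> - 1 / 2 * ln (N n)) \<in> O(\<lambda>_. 1)"
      using bound by (intro bigoI[where c="\<bar>a\<bar> + \<bar>b\<bar>"]) auto
    moreover have "(\<lambda>_. 1 :: real) \<in> o(\<lambda>n. 1 / 2 * ln (N n))"
    proof -
      have "(\<lambda>_. 1 :: real) \<in> o[at_top](\<lambda>x. 1 / 2 * ln x)" by real_asymp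
      from landau_o.small.compose[OF this Nlim] show ?thesis .
    qed
    ultimately show ?thesis
      by (intro smallo_imp_asymp_equiv) (rule landau_o.big_small_trans)
  qed
  moreover have "((\<lambda>\<alpha>. liminf (\<lambda>n. ereal (g n (1 / 2 * ln (N n) - \<alpha>)))) \<longlongrightarrow> 1) at_top"
  proof (rule tendsto_sandwich)
    have ev: "eventually (\<lambda>n. 0 \<le> 1 / 2 * ln (N n) - \<alpha>) sequentially" for \<alpha>
    proof -
      have "filterlim (\<lambda>x::real. 1 / 2 * ln x) at_top at_top" by real_asymp
      from filterlim_compose[OF this Nlim] show ?thesis by (simp add: filterlim_at_top)
    qed
    show "eventually (\<lambda>\<alpha>. ereal (1 - K * exp (- 2 * \<alpha>)) \<le> liminf (\<lambda>n. ereal (g n (1 / 2 * ln (N n) - \<alpha>)))) at_top"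
    proof (rule always_eventually, rule allI, rule Liminf_bounded)
      fix \<alpha> show "eventually (\<lambda>n. ereal (1 - K * exp (- 2 * \<alpha>)) \<le> ereal (g n (1 / 2 * ln (N n) - \<alpha>))) sequentially"
        using ev[of \<alpha>]
      proof eventually_elim
        case (elim n)
        from lower[OF this, of n] show ?case unfolding early by simp
      qed
    qed
    show "eventually (\<lambda>\<alpha>. liminf (\<lambda>n. ereal (g n (1 / 2 * ln (N n) - \<alpha>))) \<le> 1) at_top"
    proof (intro always_eventually allI)
      fix \<alpha>
      have "limsup (\<lambda>n. ereal (g n (1 / 2 * ln (N n) - \<alpha>))) \<le> 1"
        using ev[of \<alpha>] by (intro Limsup_bounded) (auto elim!: eventually_mono intro: g1)
      then show "liminf (\<lambda>n. ereal (g n (1 / 2 * ln (N n) - \<alpha>))) \<le> 1"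
        by (rule order_trans[OF Liminf_le_Limsup[OF sequentially_bot]])
    qed
    have "((\<lambda>\<alpha>. 1 - K * exp (- 2 * \<alpha>)) \<longlongrightarrow> 1) at_top" by real_asymp
    then show "((\<lambda>\<alpha>. ereal (1 - K * exp (- 2 * \<alpha>))) \<longlongrightarrow> 1) at_top"
      unfolding one_ereal_def by (rule tendsto_ereal)
  qed auto
  moreover have "((\<lambda>\<alpha>. limsup (\<lambda>n. ereal (f n (1 / 2 * ln (N n) + \<alpha>)))) \<longlongrightarrow> 0) at_top"
  proof (rule tendsto_sandwich)
    show "eventually (\<lambda>\<alpha>. 0 \<le> limsup (\<lambda>n. ereal (f n (1 / 2 * ln (N n) + \<alpha>)))) at_top"
      by (intro always_eventually allI le_Limsup) (auto intro: f0)
    show "eventually (\<lambda>\<alpha>. limsup (\<lambda>n. ereal (f n (1 / 2 * ln (N n) + \<alpha>))) \<le> ereal (sqrt 2 * exp (- \<alpha>))) at_top"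
      using eventually_ge_at_top[of 0]
    proof eventually_elim
      case (elim \<alpha>)
      have "f n (1 / 2 * ln (N n) + \<alpha>) \<le> sqrt 2 * exp (- \<alpha>)" for n
        using upper[of "1 / 2 * ln (N n) + \<alpha>" n] elim lnN[of n] unfolding late by simp
      then show ?case by (intro Limsup_bounded always_eventually) auto
    qed
    have "((\<lambda>\<alpha>. sqrt 2 * exp (- \<alpha>)) \<longlongrightarrow> 0) at_top" by real_asymp
    then show "((\<lambda>\<alpha>. ereal (sqrt 2 * exp (- \<alpha>))) \<longlongrightarrow> 0) at_top"
      unfolding zero_ereal_def by (rule tendsto_ereal)
  qed auto
  ultimately show ?thesis unfolding f_def g_def N_def by blast
qed

end
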